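(* Assume that $(\mathcal{H}_T)$, $(\mathcal{H}_K)$, $(\mathcal{H}_\varphi)$, $(\mathcal{H}_0)$, $(\mathcal{H}_1)$, $(\mathcal{H}_2)$, $(\mathcal{H}_3)$ hold and $m\in V^*$. Let $Z$ be a real Hilbert space into which $V$ is continuously embedded, and let $z\in Z$. For $\kappa>0$ and $a\in A$ define $$J_\kappa(a):=\min_{u\in\Gamma(a)}\tfrac12\|u-z\|_Z^2+\kappa R(a).$$ Then for every $a\in A$ the minimum over $\Gamma(a)$ is attained (so $J_\kappa$ is well defined on $A$), and for each $\kappa>0$ there exists $a^*\in A$ with $J_\kappa(a^* )=\inf_{b\in A}J_\kappa(b)$.
   Context: Let $V$ be a real reflexive Banach space with dual $V^*$ and duality pairing $\langle\cdot,\cdot\rangle$, let $C\subseteq V$ be nonempty, closed and convex, let $B$ be a real Banach space and $A\subseteq B$ a nonempty set of parameters. Given $T\colon B\times V\to V^*$, $\varphi\colon V\to\mathbb{R}\cup\{+\infty\}$, $K\colon C\to 2^C$ and $m\in V^*$, for $a\in A$ the mixed quasi-variational inequality $\mathrm{MQVI}(a)$ is: find $u\in C$ with $u\in K(u)$ and $\langle T(a,u),v-u\rangle+\varphi(v)-\varphi(u)\ge\langle m,v-u\rangle$ for all $v\in K(u)$. $\Gamma(a)$ denotes the set of solutions of $\mathrm{MQVI}(a)$. Hypothesis $(\mathcal{H}_T)$: $T$ is bounded (maps bounded sets to bounded sets); for each $u\in V$ the map $T(\cdot,u)\colon B\to V^*$ is linear; for each $a\in A$ the map $T(a,\cdot)\colon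 V\to V^*$ is monotone and continuous. Hypothesis $(\mathcal{H}_\varphi)$: $\varphi$ is proper, convex and lower semicontinuous, and $C\subseteq\operatorname{int}(\operatorname{dom}\varphi)$. Hypothesis $(\mathcal{H}_K)$: for every $u\in C$ the set $K(u)\subseteq C$ is nonempty, closed and convex, and (i) for any sequence $\{x_n\}\subset C$ with $x_n\rightharpoonup x$ weakly and any $y\in K(x)$ there is a sequence $\{y_n\}\subset C$ with $y_n\in K(x_n)$ and $y_n\to y$ strongly; (ii) for any sequences $\{x_n\},\{y_n\}\subset C$ with $y_n\in K(x_n)$, $x_n\rightharpoonup x$ and $y_n\rightharpoonup y$, one has $y\in K(x)$. Hypothesis $(\mathcal{H}_0)$: there is a bounded set $C_0\subseteq V$ with $K(u)\cap C_0\neq\emptyset$ for every $u\in C$, and a function $h\colon[0,\infty)\to\mathbb{R}$ with $h(t)\to+\infty$ as $t\to+\infty$ such that $\langle T(a,w),w-v_0\rangle+\varphi(w)-\varphi(v_0)\ge h(\|w\|_V)\|w\|_V$ for all $v_0\in C_0$, $a\in A$, $w\in C$. Hypothesis $(\mathcal{H}_1)$: $L$ and $E$ are Banach spaces, $B$ is continuously embedded in $L$, $E$ is compactly embedded in $L$, and $A\subseteq B\cap E$ is closed and bounded in $B$ and closed in $L$. Hypothesis $(\mathcal{H}_2)$: whenever $\{a_n\}\subset A$ is bounded in $B$ and $a_n\to a\in A$ strongly in $L$, $v_n\to v$ strongly in $V$, and $\{u_n\}\subset V$ is bounded, then $\limsup_{n\to\infty}\langle T(a_n-a,v_n),u_n\rangle\le0$.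 Hypothesis $(\mathcal{H}_3)$: $R\colon E\to\mathbb{R}$ is convex, lower semicontinuous with respect to the norm of $L$, and there are $\tau_1,\tau_2>0$ with $R(a)\ge\tau_1\|a\|_E-\tau_2$ for all $a\in A$. *)

theory Defs
  imports "HOL-Analysis.Analysis" "HOL-Library.Liminf_Limsup"
begin

text \<open>Dual of a real normed space V is modelled as the type of bounded linear
  functionals \<open>'v \<Rightarrow>\<^sub>L real\<close>; the duality pairing is function application.\<close>

definition reflexive_space :: "'v::real_normed_vector itself \<Rightarrow> bool" where
  "reflexive_space _ \<longleftrightarrow>
     (\<forall>\<Phi> :: ('v \<Rightarrow>\<^sub>L real) \<Rightarrow>\<^sub>L real. \<exists>v::'v. \<forall>f. blinfun_apply \<Phi> f = blinfun_apply f v)"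

definition weakly_conv :: "(nat \<Rightarrow> 'v::real_normed_vector) \<Rightarrow> 'v \<Rightarrow> bool" where
  "weakly_conv xs x \<longleftrightarrow>
     (\<forall>f :: 'v \<Rightarrow>\<^sub>L real. (\<lambda>n. blinfun_apply f (xs n)) \<longlonglongrightarrow> blinfun_apply f x)"

definition ereal_proper :: "('v \<Rightarrow> ereal) \<Rightarrow> bool" where
  "ereal_proper \<phi> \<longleftrightarrow> (\<forall>v. \<phi> v \<noteq> -\<infinity>) \<and> (\<exists>v. \<phi> v \<noteq> \<infinity>)"

definition ereal_convex :: "('v::real_vector \<Rightarrow> ereal) \<Rightarrow> bool" where
  "ereal_convex \<phi> \<longleftrightarrow>
     (\<forall>x y t. 0 \<le> t \<and> t \<le> 1 \<longrightarrow>
        \<phi> ((1 - t) *\<^sub>R x + t *\<^sub>R y) \<le> ereal (1 - t) * \<phi> x + ereal t * \<phi> y)"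

text \<open>(Sequential = topological, since V is a metric space) lower semicontinuity.\<close>
definition ereal_lsc :: "('v::metric_space \<Rightarrow> ereal) \<Rightarrow> bool" where
  "ereal_lsc \<phi> \<longleftrightarrow> (\<forall>xs x. xs \<longlonglongrightarrow> x \<longrightarrow> \<phi> x \<le> liminf (\<lambda>n. \<phi> (xs n)))"

definition edom :: "('v \<Rightarrow> ereal) \<Rightarrow> 'v set" where
  "edom \<phi> = {v. \<phi> v < \<infinity>}"

definition MQVI_sol ::
  "('b \<Rightarrow> 'v::real_normed_vector \<Rightarrow> ('v \<Rightarrow>\<^sub>L real)) \<Rightarrow> ('v \<Rightarrow> ereal) \<Rightarrow> ('v \<Rightarrow> 'v set)
    \<Rightarrow> 'v set \<Rightarrow> ('v \<Rightarrow>\<^sub>L real) \<Rightarrow> 'b \<Rightarrow> 'v set" where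
  "MQVI_sol T \<phi> K C m a =
     {u. u \<in> C \<and> u \<in> K u \<and>
         (\<forall>v\<in>K u. ereal (blinfun_apply (T a u) (v - u)) + \<phi> v - \<phi> u
                    \<ge> ereal (blinfun_apply m (v - u)))}"

definition compact_embedding :: "('e::real_normed_vector \<Rightarrow> 'l::real_normed_vector) \<Rightarrow> bool" where
  "compact_embedding i \<longleftrightarrow> bounded_linear i \<and> inj i \<and>
     (\<forall>S. bounded S \<longrightarrow> compact (closure (i ` S)))"

definition continuous_embedding :: "('e::real_normed_vector \<Rightarrow> 'l::real_normed_vector) \<Rightarrow> bool" where
  "continuous_embedding i \<longleftrightarrow> bounded_linear i \<and> inj i"

text \<open>The cost functional J_kappa(a) (the infimum is shown to be a minimum).\<close>
definition Jfun ::
  "('v \<Rightarrow> 'z::real_normed_vector) \<Rightarrow> 'z \<Rightarrow> ('b \<Rightarrow> 'v set) \<Rightarrow> ('e \<Rightarrow> real) \<Rightarrow> ('b \<Rightarrow> 'e)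
     \<Rightarrow> real \<Rightarrow> 'b \<Rightarrow> real" where
  "Jfun iZ z \<Gamma> R toE \<kappa> a =
     (INF u\<in>\<Gamma> a. (1/2) * (norm (iZ u - z))\<^sup>2) + \<kappa> * R (toE a)"

end

theory Submission
  imports Defs
begin

text \<open>
  Everything except the existence of solutions follows from the closedness of the solution map:
  coercivity bounds all solutions by one radius \<open>r\<close>, reflexivity gives weakly convergent
  subsequences, and Minty's formulation, in which \<open>T\<close> is evaluated at the strongly convergent
  test points, passes to the limit when the parameters converge in \<open>L\<close>. The direct method then
  yields both minima.

  For existence, the solutions of norm at most \<open>r\<close> form the intersection of a family of weakly
  closed sets: the solutions of Minty's inequality on the open ball, and for each functional \<open>f\<close>
  the points \<open>u\<close> that \<open>f\<close> does not separate from \<open>K u\<close>. If the intersection were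
  empty, finitely many bump functions supported in the complements would cover the weakly compact
  set \<open>C \<inter> cball 0 r\<close>, and summing the corresponding inequalities with the bumps as
  weights would contradict Ky Fan's inequality. The hypotheses on \<open>K\<close> concern sequences only;
  Whitley's form of the Eberlein-Smulian theorem turns weak sequential closedness into weak closedness.
\<close>

section \<open>Hahn-Banach\<close>

text \<open>The constraint set moves with the unknown, and \<open>T a\<close> is continuous only for
  the norm, so \<open>VI\<close> has no evident weak semicontinuity in \<open>u\<close>. Every
  condition is therefore expressed through \<open>minty\<close> or through a single functional. Both
  are weakly upper semicontinuous in \<open>u\<close>, and both have a nonnegative weighted average
  at a barycentre of test points; this common property is what allows conditions of different kinds
  to be added up with weights depending on \<open>u\<close>. The weak topology enters as the
  topology of pointwise convergence on functionals, where bumps depending on finitely many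
  coordinates are available. The sets \<open>K u\<close> may be unbounded, so existence is proved in
  a ball. Its radius is such that coercivity excludes truncated solutions on the sphere; a solution
  strictly inside can move a little towards any test point, and convexity along the segment removes
  the truncation.\<close>

definition sublinear :: "('v::real_vector \<Rightarrow> real) \<Rightarrow> bool" where
  "sublinear q \<longleftrightarrow> (\<forall>x y. q (x + y) \<le> q x + q y) \<and> (\<forall>c x. c \<ge> 0 \<longrightarrow> q (c *\<^sub>R x) = c * q x)"

lemma sublinear_add: "sublinear q \<Longrightarrow> q (x + y) \<le> q x + q y"
  and sublinear_scale: "sublinear q \<Longrightarrow> c \<ge> 0 \<Longrightarrow> q (c *\<^sub>R x) = c * q x"
  by (auto simp: sublinear_def)

lemma sublinear_zero: "sublinear q \<Longrightarrow> q 0 = 0"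
  using sublinear_scale[of q 0 0] by simp

lemma sublinear_minus: "sublinear q \<Longrightarrow> - q (- x) \<le> q x"
  using sublinear_add[of q x "-x"] sublinear_zero[of q] by simp

lemma sublinear_norm: "sublinear (norm :: 'v::real_normed_vector \<Rightarrow> real)"
  by (simp add: sublinear_def norm_triangle_ineq)

text \<open>Supplies the lower bounds for Zorn's lemma. The infimum is finite because
  \<open>- p (- x)\<close> lies below every \<open>q x\<close>, and it is subadditive because two
  members of a chain can both be replaced by the smaller one.\<close>

lemma sublinear_Inf_chain:
  fixes p :: "'v::real_vector \<Rightarrow> real"
  assumes ne: "Q \<noteq> {}"
    and sub: "\<And>q. q \<in> Q \<Longrightarrow> sublinear q"
    and le: "\<And>q x. q \<in> Q \<Longrightarrow> q x \<le> p x"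
    and chain: "\<And>q1 q2. q1 \<in> Q \<Longrightarrow> q2 \<in> Q \<Longrightarrow> (\<forall>x. q1 x \<le> q2 x) \<or> (\<forall>x. q2 x \<le> q1 x)"
  shows "sublinear (\<lambda>x. INF q\<in>Q. q x)" and "\<And>q x. q \<in> Q \<Longrightarrow> (INF q\<in>Q. q x) \<le> q x"
proof -
  have bdd: "bdd_below ((\<lambda>q. q x) ` Q)" for x
    unfolding bdd_below_def
  proof (rule exI, intro ballI)
    fix y assume "y \<in> (\<lambda>q. q x) ` Q"
    then obtain q where q: "q \<in> Q" "y = q x" by auto
    show "- p (- x) \<le> y"
      using sublinear_minus[OF sub[OF q(1)], of x] le[OF q(1), of "-x"] q(2) by linarith
  qed
  show low: "(INF q\<in>Q. q x) \<le> q x" if "q \<in> Q" for q x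
    by (rule cINF_lower[OF bdd that])
  show "sublinear (\<lambda>x. INF q\<in>Q. q x)"
    unfolding sublinear_def
  proof (intro conjI allI impI)
    fix x y :: 'v
    have *: "(INF q\<in>Q. q (x + y)) \<le> q1 x + q2 y" if q: "q1 \<in> Q" "q2 \<in> Q" for q1 q2
    proof -
      have "\<exists>q\<in>Q. q x \<le> q1 x \<and> q y \<le> q2 y" using chain[OF q] q by blast
      then obtain q where "q \<in> Q" "q x \<le> q1 x" "q y \<le> q2 y" by blast
      then show ?thesis
        using low[of q "x + y"] sublinear_add[OF sub, of q x y] by linarith
    qed
    have "(INF q\<in>Q. q (x + y)) - q1 x \<le> (INF q\<in>Q. q y)" if "q1 \<in> Q" for q1
      by (rule cINF_greatest[OF ne]) (use *[OF that] in force)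
    then have "(INF q\<in>Q. q (x + y)) - (INF q\<in>Q. q y) \<le> (INF q\<in>Q. q x)"
      by (intro cINF_greatest[OF ne]) force
    then show "(INF q\<in>Q. q (x + y)) \<le> (INF q\<in>Q. q x) + (INF q\<in>Q. q y)" by linarith
  next
    fix c :: real and x :: 'v assume c: "c \<ge> 0"
    have "(INF q\<in>Q. q (c *\<^sub>R x)) = (INF q\<in>Q. c * q x)"
      using sub c by (intro INF_cong) (auto simp: sublinear_scale)
    also have "\<dots> = c * (INF q\<in>Q. q x)"
    proof (cases "c = 0")
      case False
      with c have c: "c > 0" by simp
      show ?thesis
      proof (rule antisym)
        have bdd': "bdd_below ((\<lambda>q. c * q x) ` Q)"
        proof -
          obtain b where "b \<le> q x" if "q \<in> Q" for q using bdd[of x] by (auto simp: bdd_below_def)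
          then show ?thesis using c by (intro bdd_belowI[of _ "c * b"]) auto
        qed
        have "(INF q\<in>Q. c * q x) / c \<le> (INF q\<in>Q. q x)"
          using c cINF_lower[OF bdd']
          by (intro cINF_greatest[OF ne]) (simp add: divide_le_eq mult.commute)
        then show "(INF q\<in>Q. c * q x) \<le> c * (INF q\<in>Q. q x)"
          using c by (simp add: divide_le_eq mult.commute)
        show "c * (INF q\<in>Q. q x) \<le> (INF q\<in>Q. c * q x)"
          using c low by (intro cINF_greatest[OF ne]) simp
      qed
    qed (use ne in simp)
    finally show "(INF q\<in>Q. q (c *\<^sub>R x)) = c * (INF q\<in>Q. q x)" .
  qed
qed

text \<open>The witness is the infimal convolution \<open>p x = Inf {q (x + t d) - t \<delta>}\<close> over \<open>t \<ge> 0\<close> and \<open>d \<in> D\<close>.\<close>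

lemma sublinear_dominated_by_neg:
  fixes q :: "'v::real_vector \<Rightarrow> real"
  assumes q: "sublinear q" and D: "convex D" "D \<noteq> {}" and ge: "\<And>d. d \<in> D \<Longrightarrow> \<delta> \<le> q d"
  obtains p where "sublinear p" "\<And>x. p x \<le> q x" "\<And>d. d \<in> D \<Longrightarrow> p (- d) \<le> - \<delta>"
proof -
  define S where "S x = {q (x + t *\<^sub>R d) - t * \<delta> | t d. 0 \<le> t \<and> d \<in> D}" for x
  define p where "p x = Inf (S x)" for x
  obtain d0 where d0: "d0 \<in> D" using D by blast
  have SI: "q (x + t *\<^sub>R d) - t * \<delta> \<in> S x" if "0 \<le> t" "d \<in> D" for x t d
    using that unfolding S_def by blast
  have ne: "S x \<noteq> {}" for x using SI[OF order_refl d0] by blast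
  have bdd: "bdd_below (S x)" for x
    unfolding bdd_below_def
  proof (rule exI, intro ballI)
    fix y assume "y \<in> S x"
    then obtain t d where td: "y = q (x + t *\<^sub>R d) - t * \<delta>" "0 \<le> t" "d \<in> D"
      unfolding S_def by blast
    have "t * \<delta> \<le> t * q d" using td ge by (simp add: mult_left_mono)
    also have "\<dots> = q (t *\<^sub>R d)" using sublinear_scale[OF q td(2)] by simp
    also have "\<dots> \<le> q (x + t *\<^sub>R d) + q (- x)"
      using sublinear_add[OF q, of "x + t *\<^sub>R d" "- x"] by simp
    finally show "- q (- x) \<le> y" using td by simp
  qed
  have low: "p x \<le> q (x + t *\<^sub>R d) - t * \<delta>" if "0 \<le> t" "d \<in> D" for x t d
    unfolding p_def by (rule cInf_lower[OF SI[OF that] bdd])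
  have great: "c \<le> p x" if "\<And>t d. 0 \<le> t \<Longrightarrow> d \<in> D \<Longrightarrow> c \<le> q (x + t *\<^sub>R d) - t * \<delta>" for c x
    unfolding p_def by (rule cInf_greatest[OF ne]) (use that S_def in auto)
  have p0: "p 0 = 0"
  proof (rule antisym)
    show "p 0 \<le> 0" using low[OF order_refl d0, of 0] sublinear_zero[OF q] by simp
    show "0 \<le> p 0"
      using ge sublinear_scale[OF q] by (intro great) (simp add: mult_left_mono)
  qed
  have scale_le: "p (c *\<^sub>R x) \<le> c * p x" if c: "c > 0" for c :: real and x
  proof -
    have "p (c *\<^sub>R x) / c \<le> p x"
    proof (rule great)
      fix t :: real and d assume td: "0 \<le> t" "d \<in> D"
      have "p (c *\<^sub>R x) \<le> q (c *\<^sub>R x + (c * t) *\<^sub>R d) - (c * t) * \<delta>"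
        using td c by (intro low) auto
      also have "c *\<^sub>R x + (c * t) *\<^sub>R d = c *\<^sub>R (x + t *\<^sub>R d)" by (simp add: scaleR_add_right)
      also have "q \<dots> = c * q (x + t *\<^sub>R d)" using sublinear_scale[OF q] c by simp
      finally have "p (c *\<^sub>R x) \<le> (q (x + t *\<^sub>R d) - t * \<delta>) * c"
        by (simp add: algebra_simps)
      then show "p (c *\<^sub>R x) / c \<le> q (x + t *\<^sub>R d) - t * \<delta>"
        using c by (simp only: pos_divide_le_eq)
    qed
    then show ?thesis using c by (simp add: divide_le_eq mult.commute)
  qed
  have scale: "p (c *\<^sub>R x) = c * p x" if "c \<ge> 0" for c :: real and x
  proof (cases "c = 0")
    case False
    with that have c: "c > 0" by simp
    have "p ((1/c) *\<^sub>R (c *\<^sub>R x)) \<le> (1/c) * p (c *\<^sub>R x)" by (rule scale_le) (use c in simp)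
    then have "c * p x \<le> p (c *\<^sub>R x)" using c by (simp add: le_divide_eq mult.commute)
    with scale_le[OF c, of x] show ?thesis by simp
  qed (simp add: p0)
  have "p (x + y) \<le> p x + p y" for x y
  proof -
    have *: "p (x + y) \<le> (q (x + t1 *\<^sub>R d1) - t1 * \<delta>) + (q (y + t2 *\<^sub>R d2) - t2 * \<delta>)"
      if t: "0 \<le> t1" "d1 \<in> D" "0 \<le> t2" "d2 \<in> D" for t1 d1 t2 d2
    proof -
      \<comment> \<open>Convexity of \<open>D\<close> enters here: the cone it generates is closed
        under addition, so two shifts combine into one.\<close>
      have "\<exists>d\<in>D. t1 *\<^sub>R d1 + t2 *\<^sub>R d2 = (t1 + t2) *\<^sub>R d"
      proof (cases "t1 + t2 = 0")
        case True
        with t have "t1 = 0" "t2 = 0" by auto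
        with t show ?thesis by auto
      next
        case False
        with t have pos: "t1 + t2 > 0" by simp
        have "(t1 / (t1 + t2)) *\<^sub>R d1 + (t2 / (t1 + t2)) *\<^sub>R d2 \<in> D"
          using t pos by (intro convexD[OF D(1)]) (auto simp flip: add_divide_distrib)
        then show ?thesis
          using pos by (intro bexI) (auto simp: scaleR_add_right)
      qed
      then obtain d where d: "d \<in> D" "t1 *\<^sub>R d1 + t2 *\<^sub>R d2 = (t1 + t2) *\<^sub>R d" by blast
      have "p (x + y) \<le> q (x + y + (t1 + t2) *\<^sub>R d) - (t1 + t2) * \<delta>"
        using t d by (intro low) auto
      also have "x + y + (t1 + t2) *\<^sub>R d = (x + t1 *\<^sub>R d1) + (y + t2 *\<^sub>R d2)"
        using d(2) by (simp add: algebra_simps)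
      also have "q \<dots> \<le> q (x + t1 *\<^sub>R d1) + q (y + t2 *\<^sub>R d2)" by (rule sublinear_add[OF q])
      finally show ?thesis by (simp add: algebra_simps)
    qed
    have "p (x + y) - (q (x + t1 *\<^sub>R d1) - t1 * \<delta>) \<le> p y" if "0 \<le> t1" "d1 \<in> D" for t1 d1
      by (rule great) (use *[OF that] in force)
    then have "p (x + y) - p y \<le> p x" by (intro great) force
    then show ?thesis by linarith
  qed
  with scale have "sublinear p" unfolding sublinear_def by blast
  moreover have "p x \<le> q x" for x using low[OF order_refl d0, of x] by simp
  moreover have "p (- d) \<le> - \<delta>" if "d \<in> D" for d
    using low[of 1 d "- d"] that sublinear_zero[OF q] by simp
  ultimately show ?thesis by (rule that)
qed

text \<open>A minimal sublinear functional is linear: otherwise the previous lemma with a singleton \<open>D\<close> would lower it.\<close>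

lemma ex_linear_le_sublinear:
  fixes p :: "'v::real_vector \<Rightarrow> real"
  assumes p: "sublinear p"
  obtains f where "linear f" "\<And>x. f x \<le> p x"
proof -
  define A where "A = {q. sublinear q \<and> (\<forall>x. q x \<le> p x)}"
  define P where "P = (\<lambda>q1 q2 :: 'v \<Rightarrow> real. \<forall>x. q2 x \<le> q1 x)"
  have "\<exists>m\<in>A. \<forall>a\<in>A. P m a \<longrightarrow> a = m"
  proof (rule predicate_Zorn)
    show "partial_order_on A (relation_of P A)"
      by (rule partial_order_on_relation_ofI) (auto simp: P_def fun_eq_iff intro: order_trans antisym)
    fix Ch assume Ch: "Ch \<in> Chains (relation_of P A)"
    then have sub: "Ch \<subseteq> A" unfolding Chains_def relation_of_def by auto
    show "\<exists>u\<in>A. \<forall>a\<in>Ch. P a u"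
    proof (cases "Ch = {}")
      case True
      then show ?thesis using p by (auto simp: A_def)
    next
      case False
      note * = sublinear_Inf_chain[OF False, of p]
      have 1: "sublinear q" "q x \<le> p x" if "q \<in> Ch" for q x using that sub by (auto simp: A_def)
      have 2: "(\<forall>x. q1 x \<le> q2 x) \<or> (\<forall>x. q2 x \<le> q1 x)" if "q1 \<in> Ch" "q2 \<in> Ch" for q1 q2
        using Ch that unfolding Chains_def relation_of_def P_def by auto
      have s: "sublinear (\<lambda>x. INF q\<in>Ch. q x)" by (rule *(1)) (use 1 2 in auto)
      have l: "(INF q\<in>Ch. q x) \<le> q x" if "q \<in> Ch" for q x
        by (rule *(2)) (use 1 2 that in auto)
      obtain q where q: "q \<in> Ch" using False by blast
      have "(INF q\<in>Ch. q x) \<le> p x" for x using l[OF q, of x] 1(2)[OF q, of x] by linarith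
      with s l show ?thesis by (intro bexI[of _ "\<lambda>x. INF q\<in>Ch. q x"]) (auto simp: P_def A_def)
    qed
  qed
  then obtain m where mA: "m \<in> A" and max: "\<forall>a\<in>A. P m a \<longrightarrow> a = m" by blast
  have m: "sublinear m" "\<And>x. m x \<le> p x" using mA by (auto simp: A_def)
  have min: "a = m" if a: "sublinear a" "\<And>x. a x \<le> m x" for a
  proof -
    have "a \<in> A" using a m(2) by (auto simp: A_def intro: order_trans)
    with max a show ?thesis by (auto simp: P_def)
  qed
  have neg: "m (- x) = - m x" for x
  proof -
    obtain a where a: "sublinear a" "\<And>y. a y \<le> m y" "\<And>d. d \<in> {x} \<Longrightarrow> a (- d) \<le> - m x"
      by (rule sublinear_dominated_by_neg[OF m(1), of "{x}" "m x"]) auto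
    with min[OF a(1,2)] have "m (- x) \<le> - m x" by auto
    with sublinear_minus[OF m(1), of x] show ?thesis by linarith
  qed
  have "linear m"
  proof
    show "m (x + y) = m x + m y" for x y
      using sublinear_add[OF m(1), of x y] sublinear_add[OF m(1), of "x + y" "- y"] neg[of y] by simp
    show "m (c *\<^sub>R x) = c *\<^sub>R m x" for c x
      using sublinear_scale[OF m(1), of c x] sublinear_scale[OF m(1), of "- c" x] neg[of "c *\<^sub>R x"]
      by (cases "c \<ge> 0") auto
  qed
  with m show ?thesis by (intro that)
qed

text \<open>A linear \<open>g\<close> below \<open>p\<close> has norm at most 1 because
  \<open>p\<close> lies below the norm, and \<open>g (- d) \<le> - \<delta>\<close> is the wanted
  bound after a change of sign. A singleton \<open>D\<close> yields norming functionals, a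
  translated convex set yields separation.\<close>

theorem mazur_orlicz:
  fixes D :: "'v::real_normed_vector set"
  assumes D: "convex D" "D \<noteq> {}" and ge: "\<And>d. d \<in> D \<Longrightarrow> \<delta> \<le> norm d"
  obtains f :: "'v \<Rightarrow>\<^sub>L real" where "norm f \<le> 1" "\<And>d. d \<in> D \<Longrightarrow> \<delta> \<le> blinfun_apply f d"
proof -
  obtain p :: "'v \<Rightarrow> real" where p: "sublinear p" "\<And>x. p x \<le> norm x" "\<And>d. d \<in> D \<Longrightarrow> p (- d) \<le> - \<delta>"
    using sublinear_dominated_by_neg[OF sublinear_norm D ge] by blast
  obtain g where g: "linear g" "\<And>x. g x \<le> p x" using ex_linear_le_sublinear[OF p(1)] by blast
  have abs: "norm (g x) \<le> norm x * 1" for x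
    using g(2)[of x] p(2)[of x] g(2)[of "-x"] p(2)[of "-x"] linear_neg[OF g(1), of x] by auto
  have bl: "bounded_linear g"
    using g(1) abs by (intro bounded_linear.intro) (auto simp only: bounded_linear_axioms_def)
  show ?thesis
  proof (rule that[of "Blinfun g"])
    show "norm (Blinfun g) \<le> 1"
      using abs by (intro norm_blinfun_bound) (auto simp: bounded_linear_Blinfun_apply[OF bl])
    fix d assume "d \<in> D"
    then show "\<delta> \<le> blinfun_apply (Blinfun g) d"
      using g(2)[of "-d"] p(3)[of d] linear_neg[OF g(1), of d]
      by (simp add: bounded_linear_Blinfun_apply[OF bl])
  qed
qed

lemma norming_functional:
  fixes x :: "'v::real_normed_vector"
  obtains f :: "'v \<Rightarrow>\<^sub>L real" where "norm f \<le> 1" "blinfun_apply f x = norm x"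
proof -
  obtain f :: "'v \<Rightarrow>\<^sub>L real" where f: "norm f \<le> 1" "norm x \<le> blinfun_apply f x"
    using mazur_orlicz[of "{x}" "norm x"] by auto
  have "blinfun_apply f x \<le> norm f * norm x" using norm_blinfun[of f x] by auto
  also have "\<dots> \<le> norm x" using f mult_right_mono[of "norm f" 1 "norm x"] by simp
  finally show ?thesis using f that by force
qed

text \<open>The complement of \<open>S\<close> is open, so \<open>S\<close> translated by
  \<open>- x\<close> keeps a positive distance from 0; this distance is the gap.\<close>

lemma separate_point_closed_convex:
  fixes S :: "'v::real_normed_vector set"
  assumes S: "closed S" "convex S" and x: "x \<notin> S"
  obtains f :: "'v \<Rightarrow>\<^sub>L real" and \<delta> where "\<delta> > 0" "\<And>y. y \<in> S \<Longrightarrow> blinfun_apply f x + \<delta> \<le> blinfun_apply f y"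
proof (cases "S = {}")
  case True
  then show ?thesis using that[of 1 0] by auto
next
  case False
  obtain e where e: "e > 0" "\<And>y. y \<in> S \<Longrightarrow> e \<le> dist x y"
  proof -
    have "open (- S)" "x \<in> - S" using S x by auto
    then obtain e where "e > 0" "\<And>y. dist y x < e \<Longrightarrow> y \<in> - S" unfolding open_dist by blast
    then show ?thesis by (intro that[of e]) (force simp: dist_commute not_less[symmetric])+
  qed
  obtain f :: "'v \<Rightarrow>\<^sub>L real" where "norm f \<le> 1" and f: "\<And>d. d \<in> (\<lambda>y. y - x) ` S \<Longrightarrow> e \<le> blinfun_apply f d"
  proof (rule mazur_orlicz[of "(\<lambda>y. y - x) ` S" e])
    show "convex ((\<lambda>y. y - x) ` S)" using S(2) convex_translation_subtract by auto
    show "e \<le> norm d" if "d \<in> (\<lambda>y. y - x) ` S" for d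
      using that e(2) by (auto simp: dist_norm norm_minus_commute)
  qed (use False in auto)
  show ?thesis
  proof (rule that[OF e(1)])
    show "blinfun_apply f x + e \<le> blinfun_apply f y" if "y \<in> S" for y
      using f[of "y - x"] that by (auto simp: blinfun.diff_right)
  qed
qed

section \<open>Weak compactness\<close>

lemma tendsto_funI:
  fixes f :: "'a \<Rightarrow> 'i \<Rightarrow> 'b::topological_space"
  assumes "\<And>i. ((\<lambda>n. f n i) \<longlongrightarrow> l i) F"
  shows "(f \<longlongrightarrow> l) F"
proof -
  have "limitin (product_topology (\<lambda>i. euclidean) UNIV) f l F"
    unfolding limitin_componentwise using assms by (auto simp: extensional_def)
  then show ?thesis by (simp add: euclidean_product_topology)
qed

text \<open>A basic open set of the product restricts finitely many coordinates, so a tent function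
  of the summed distances in these coordinates is continuous. Such bumps serve as weakly continuous
  weights subordinate to a cover.\<close>

lemma product_bump:
  fixes \<Phi> :: "'i \<Rightarrow> real"
  assumes "open U" "\<Phi> \<in> U"
  obtains b :: "('i \<Rightarrow> real) \<Rightarrow> real" where "continuous_on UNIV b" "\<And>\<Psi>. 0 \<le> b \<Psi>" "0 < b \<Phi>"
    "\<And>\<Psi>. 0 < b \<Psi> \<Longrightarrow> \<Psi> \<in> U"
proof -
  have "openin (product_topology (\<lambda>i. euclidean) UNIV) U"
    using assms(1) by (simp add: open_fun_def)
  from product_topology_open_contains_basis[OF this assms(2)]
  obtain X where X: "\<And>i. \<Phi> i \<in> X i" "\<And>i. open (X i)" "finite {i. X i \<noteq> UNIV}" "(\<Pi>\<^sub>E i\<in>UNIV. X i) \<subseteq> U"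
    by (auto simp: PiE_iff)
  have "\<exists>e>0. ball (\<Phi> i) e \<subseteq> X i" for i using X(1,2) open_contains_ball by blast
  then obtain e where e: "\<And>i. e i > 0" "\<And>i. ball (\<Phi> i) (e i) \<subseteq> X i" by metis
  define G where "G = {i. X i \<noteq> UNIV}"
  \<comment> \<open>The inserted 1 keeps the minimum meaningful when no coordinate is
    restricted.\<close>
  define \<epsilon> where "\<epsilon> = Min (insert 1 (e ` G))"
  have G: "finite G" using X(3) by (simp add: G_def)
  have \<epsilon>: "\<epsilon> > 0" "\<And>i. i \<in> G \<Longrightarrow> \<epsilon> \<le> e i" using G e(1) by (auto simp: \<epsilon>_def)
  show ?thesis
  proof (rule that[of "\<lambda>\<Psi>. max 0 (\<epsilon> - (\<Sum>i\<in>G. \<bar>\<Psi> i - \<Phi> i\<bar>))"])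
    show "continuous_on UNIV (\<lambda>\<Psi>. max 0 (\<epsilon> - (\<Sum>i\<in>G. \<bar>\<Psi> i - \<Phi> i\<bar>)))"
      by (intro continuous_intros continuous_on_product_coordinates)
    show "0 < max 0 (\<epsilon> - (\<Sum>i\<in>G. \<bar>\<Phi> i - \<Phi> i\<bar>))" using \<epsilon> by simp
    fix \<Psi> assume "0 < max 0 (\<epsilon> - (\<Sum>i\<in>G. \<bar>\<Psi> i - \<Phi> i\<bar>))"
    then have s: "(\<Sum>i\<in>G. \<bar>\<Psi> i - \<Phi> i\<bar>) < \<epsilon>" by (auto simp: max_def split: if_splits)
    have "\<Psi> i \<in> X i" for i
    proof (cases "i \<in> G")
      case True
      have "\<bar>\<Psi> i - \<Phi> i\<bar> \<le> (\<Sum>i\<in>G. \<bar>\<Psi> i - \<Phi> i\<bar>)" using G True by (intro member_le_sum) auto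
      with s \<epsilon>(2)[OF True] have "\<Psi> i \<in> ball (\<Phi> i) (e i)" by (simp add: dist_real_def abs_minus_commute)
      with e(2) show ?thesis by blast
    qed (simp add: G_def)
    with X(4) show "\<Psi> \<in> U" by auto
  qed simp
qed

text \<open>Realises the weak topology without a second topology on the type: evaluation embeds the
  space into a product of real lines, and weak closedness and compactness are stated for images in
  this product.\<close>

definition weak_map :: "'v::real_normed_vector \<Rightarrow> ('v \<Rightarrow>\<^sub>L real) \<Rightarrow> real" where
  "weak_map v f = blinfun_apply f v"

lemma weakly_conv_tendsto: "weakly_conv xs x \<Longrightarrow> (\<lambda>n. weak_map (xs n)) \<longlonglongrightarrow> weak_map x"
  by (rule tendsto_funI) (simp add: weakly_conv_def weak_map_def)

lemma weakly_conv_subseq: "weakly_conv xs x \<Longrightarrow> strict_mono s \<Longrightarrow> weakly_conv (xs \<circ> s) x"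
  by (auto simp: weakly_conv_def comp_def dest: LIMSEQ_subseq_LIMSEQ[unfolded comp_def])

lemma tendsto_imp_weakly_conv: "xs \<longlonglongrightarrow> x \<Longrightarrow> weakly_conv xs x"
  unfolding weakly_conv_def by (auto intro!: tendsto_intros)

lemma continuous_on_weak_map: "continuous_on S weak_map"
proof (rule continuous_on_coordinatewise_then_product)
  show "continuous_on S (\<lambda>x. weak_map x f)" for f
    unfolding weak_map_def by (intro continuous_intros)
qed

lemma closed_convex_weakly_closed:
  fixes S :: "'v::real_normed_vector set"
  assumes S: "closed S" "convex S" and xs: "\<And>n. xs n \<in> S" "weakly_conv xs x"
  shows "x \<in> S"
proof (rule ccontr)
  assume "x \<notin> S"
  then obtain f :: "'v \<Rightarrow>\<^sub>L real" and \<delta> where "\<delta> > 0" and f: "\<And>y. y \<in> S \<Longrightarrow> blinfun_apply f x + \<delta> \<le> blinfun_apply f y"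
    using separate_point_closed_convex[OF S] by blast
  have "(\<lambda>n. blinfun_apply f (xs n)) \<longlonglongrightarrow> blinfun_apply f x" using xs(2) by (simp add: weakly_conv_def)
  then have "blinfun_apply f x + \<delta> \<le> blinfun_apply f x"
    by (rule LIMSEQ_le_const) (use f xs(1) in auto)
  with \<open>\<delta> > 0\<close> show False by simp
qed

text \<open>Banach-Alaoglu on the bidual: the image is the Tychonoff product of the intervals
  \<open>[- r * norm f, r * norm f]\<close> cut with the closed conditions of additivity and
  homogeneity. Reflexivity turns each such functional into an evaluation, and a norming functional
  recovers the bound on the point.\<close>

lemma weak_map_cball:
  assumes refl: "reflexive_space TYPE('v::real_normed_vector)" and r: "r \<ge> 0"
  shows "compact (weak_map ` cball (0::'v) r)" "closed (weak_map ` cball (0::'v) r)"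
proof -
  define P where "P = (\<Pi>\<^sub>E f\<in>(UNIV :: ('v \<Rightarrow>\<^sub>L real) set). {- (r * norm f) .. r * norm f})"
  define L where "L = {\<Phi> :: ('v \<Rightarrow>\<^sub>L real) \<Rightarrow> real. (\<forall>f g. \<Phi> (f + g) = \<Phi> f + \<Phi> g) \<and> (\<forall>c f. \<Phi> (c *\<^sub>R f) = c * \<Phi> f)}"
  have coord: "continuous_on UNIV (\<lambda>\<Phi> :: ('v \<Rightarrow>\<^sub>L real) \<Rightarrow> real. \<Phi> f)" for f
    by (rule continuous_on_product_coordinates)
  have L: "closed L"
    unfolding L_def
    by (intro closed_Collect_conj closed_Collect_all closed_Collect_eq continuous_intros coord)
  have "compactin (product_topology (\<lambda>f. euclidean) UNIV) P"
    unfolding P_def compactin_PiE by simp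
  then have cP: "compact P" by (simp add: euclidean_product_topology)
  have "P = {\<Phi>. \<forall>f. - (r * norm f) \<le> \<Phi> f \<and> \<Phi> f \<le> r * norm f}"
    by (auto simp: P_def PiE_iff)
  also have "closed \<dots>"
    by (intro closed_Collect_conj closed_Collect_all closed_Collect_le continuous_intros coord)
  finally have P: "closed P" .
  have "weak_map ` cball (0::'v) r = P \<inter> L"
  proof (intro set_eqI iffI)
    fix \<Phi> assume "\<Phi> \<in> weak_map ` cball (0::'v) r"
    then obtain v where v: "norm v \<le> r" "\<Phi> = weak_map v" by auto
    have "\<bar>blinfun_apply f v\<bar> \<le> r * norm f" for f :: "'v \<Rightarrow>\<^sub>L real"
      using norm_blinfun[of f v] v(1) mult_left_mono[of "norm v" r "norm f"] by (simp add: mult.commute)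
    then have "\<Phi> \<in> P" by (auto simp: P_def v weak_map_def abs_le_iff minus_le_iff)
    moreover have "\<Phi> \<in> L" by (auto simp: L_def v weak_map_def blinfun.bilinear_simps)
    ultimately show "\<Phi> \<in> P \<inter> L" by simp
  next
    fix \<Phi> assume \<Phi>: "\<Phi> \<in> P \<inter> L"
    have b: "norm (\<Phi> f) \<le> norm f * r" for f
    proof -
      have "\<Phi> f \<in> {- (r * norm f) .. r * norm f}" using \<Phi> by (auto simp: P_def)
      then show ?thesis by (simp add: abs_le_iff mult.commute minus_le_iff)
    qed
    have bl: "bounded_linear \<Phi>"
      by (rule bounded_linear_intro[OF _ _ b]) (use \<Phi> in \<open>auto simp: L_def\<close>)
    obtain v where v: "\<And>f. \<Phi> f = blinfun_apply f v"
      using refl[unfolded reflexive_space_def, rule_format, of "Blinfun \<Phi>"]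
      by (auto simp: bounded_linear_Blinfun_apply[OF bl])
    obtain f where f: "norm f \<le> 1" "blinfun_apply f v = norm v" by (rule norming_functional)
    have "norm v \<le> r"
      using b[of f] v[of f] f mult_right_mono[of "norm f" 1 r] r by simp
    moreover have "\<Phi> = weak_map v" using v by (auto simp: weak_map_def)
    ultimately show "\<Phi> \<in> weak_map ` cball (0::'v) r" by simp
  qed
  with compact_Int_closed[OF cP L] closed_Int[OF P L]
  show "compact (weak_map ` cball (0::'v) r)" "closed (weak_map ` cball (0::'v) r)" by simp_all
qed

text \<open>Formulated for arbitrary filters because it is applied both along a whole sequence and
  along only those indices at which some functional stays away from its expected limit. A cluster
  point alone does not give a subsequence, since the weak topology need not be metrizable.\<close>

lemma weak_cluster_point:
  fixes xs :: "'i \<Rightarrow> 'v::real_normed_vector"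
  assumes refl: "reflexive_space TYPE('v)" and F: "F \<noteq> bot" and b: "\<And>i. norm (xs i) \<le> r"
  obtains y where "\<And>U. open U \<Longrightarrow> weak_map y \<in> U \<Longrightarrow> \<exists>\<^sub>F i in F. weak_map (xs i) \<in> U"
proof -
  have r: "r \<ge> 0" using order_trans[OF norm_ge_zero b] .
  have "filtermap (\<lambda>i. weak_map (xs i)) F \<noteq> bot" using F by (simp add: filtermap_bot_iff)
  moreover have "eventually (\<lambda>\<Phi>. \<Phi> \<in> weak_map ` cball (0::'v) r) (filtermap (\<lambda>i. weak_map (xs i)) F)"
    using b by (simp add: eventually_filtermap)
  ultimately obtain \<Phi> where "\<Phi> \<in> weak_map ` cball (0::'v) r"
    and ne: "inf (nhds \<Phi>) (filtermap (\<lambda>i. weak_map (xs i)) F) \<noteq> bot"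
    using weak_map_cball(1)[OF refl r] unfolding compact_filter by blast
  then obtain y where y: "\<Phi> = weak_map y" by blast
  show ?thesis
  proof (rule that[of y])
    fix U assume U: "open U" "weak_map y \<in> U"
    show "\<exists>\<^sub>F i in F. weak_map (xs i) \<in> U"
      unfolding frequently_def
    proof
      assume "\<forall>\<^sub>F i in F. weak_map (xs i) \<notin> U"
      then have "eventually (\<lambda>\<Phi>. \<Phi> \<notin> U) (filtermap (\<lambda>i. weak_map (xs i)) F)"
        by (simp add: eventually_filtermap)
      moreover have "eventually (\<lambda>\<Phi>. \<Phi> \<in> U) (nhds \<Phi>)"
        using U y by (auto simp: eventually_nhds)
      ultimately have "eventually (\<lambda>_. False) (inf (nhds \<Phi>) (filtermap (\<lambda>i. weak_map (xs i)) F))"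
        unfolding eventually_inf by blast
      with ne show False by (simp add: eventually_False)
    qed
  qed
qed

lemma open_weak_near: "open {\<Psi> :: 'i \<Rightarrow> real. \<bar>\<Psi> f - c\<bar> < e}"
  by (intro open_Collect_less continuous_intros continuous_on_product_coordinates)

section \<open>The Eberlein-Smulian theorem\<close>

lemma closure_differences:
  fixes U :: "'v::real_normed_vector set"
  assumes "\<And>p q. p \<in> U \<Longrightarrow> q \<in> U \<Longrightarrow> p - q \<in> U" "p \<in> closure U" "q \<in> closure U"
  shows "p - q \<in> closure U"
proof -
  obtain a b where "\<And>n. a n \<in> U" "a \<longlonglongrightarrow> p" "\<And>n. b n \<in> U" "b \<longlonglongrightarrow> q"
    using assms(2,3) unfolding closure_sequential by blast
  then show ?thesis
    unfolding closure_sequential using assms(1)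
    by (intro exI[of _ "\<lambda>n. a n - b n"]) (auto intro: tendsto_diff)
qed

text \<open>Real multiples of points of \<open>U\<close> are limits of rational ones, and a second
  limit extends this to the closure. Countably many operations thus suffice to obtain a convex
  closure, to which separation applies.\<close>

lemma convex_closure_rational_subspace:
  fixes U :: "'v::real_normed_vector set"
  assumes diff: "\<And>p q. p \<in> U \<Longrightarrow> q \<in> U \<Longrightarrow> p - q \<in> U"
    and scale: "\<And>c p. c \<in> \<rat> \<Longrightarrow> p \<in> U \<Longrightarrow> c *\<^sub>R p \<in> U"
  shows "convex (closure U)"
proof -
  have *: "c *\<^sub>R p \<in> closure U" if p: "p \<in> U" for c :: real and p
  proof -
    have "(\<lambda>c. c *\<^sub>R p) ` closure \<rat> \<subseteq> closure U"
      by (rule image_closure_subset)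
        (use scale[OF _ p] closure_subset in \<open>auto intro!: continuous_intros\<close>)
    then show ?thesis unfolding Rats_closure_real by auto
  qed
  have **: "c *\<^sub>R p \<in> closure U" if "p \<in> closure U" for c :: real and p
  proof -
    have "(\<lambda>p. c *\<^sub>R p) ` closure U \<subseteq> closure U"
      by (rule image_closure_subset) (use * in \<open>auto intro!: continuous_intros\<close>)
    with that show ?thesis by blast
  qed
  show ?thesis
  proof (rule convexI)
    fix x y and u v :: real assume "x \<in> closure U" "y \<in> closure U"
    then have "u *\<^sub>R x - (- v) *\<^sub>R y \<in> closure U" by (intro closure_differences diff **)
    then show "u *\<^sub>R x + v *\<^sub>R y \<in> closure U" by simp
  qed
qed

text \<open>One functional is fixed for each point, so that the finite stages of the construction
  below control finitely many functionals each.\<close>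

definition norming :: "'v::real_normed_vector \<Rightarrow> 'v \<Rightarrow>\<^sub>L real" where
  "norming d = (SOME f. norm f \<le> 1 \<and> blinfun_apply f d = norm d)"

lemma norming: "norm (norming d) \<le> 1" "blinfun_apply (norming d) d = norm d"
proof -
  have "\<exists>f :: 'a \<Rightarrow>\<^sub>L real. norm f \<le> 1 \<and> blinfun_apply f d = norm d"
    using norming_functional[of d] by blast
  from someI_ex[OF this] show "norm (norming d) \<le> 1" "blinfun_apply (norming d) d = norm d"
    by (auto simp: norming_def)
qed

text \<open>If \<open>d\<close> is close to \<open>w\<close> and \<open>norming d\<close> vanishes
  at \<open>w\<close>, then \<open>norm d\<close> is the value of \<open>norming d\<close> at
  \<open>d - w\<close> and hence at most \<open>norm (d - w)\<close>. So \<open>d\<close>, and with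
  it \<open>w\<close>, is small.\<close>

lemma norming_separates_closure:
  fixes w :: "'v::real_normed_vector"
  assumes w: "w \<in> closure U" and z: "\<And>d. d \<in> U \<Longrightarrow> blinfun_apply (norming d) w = 0"
  shows "w = 0"
proof -
  have "norm w \<le> e" if e: "e > 0" for e
  proof -
    obtain d where d: "d \<in> U" "dist d w < e / 2"
      using w e unfolding closure_approachable by (meson half_gt_zero)
    have "norm d = blinfun_apply (norming d) (d - w)"
      using z[OF d(1)] norming(2)[of d] by (simp add: blinfun.diff_right)
    also have "\<dots> \<le> norm (norming d) * norm (d - w)"
      using norm_blinfun[of "norming d" "d - w"] by simp
    also have "\<dots> \<le> norm (d - w)" using norming(1)[of d] mult_right_mono[of _ 1 "norm (d - w)"] by simp
    finally have "norm d \<le> e / 2" using d(2) by (simp add: dist_norm)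
    moreover have "norm w \<le> norm d + norm (d - w)"
      using norm_triangle_ineq4[of d "d - w"] by simp
    ultimately show ?thesis using d(2) by (simp add: dist_norm)
  qed
  then have "norm w \<le> 0" by (rule field_le_epsilon[of _ 0, simplified])
  then show ?thesis by simp
qed

text \<open>The sets \<open>E k\<close> built below exhaust a countable rational subspace containing the points chosen
  so far, and each new point is close to \<open>x\<close> on the norming functionals of that stage. A weak cluster
  point \<open>y\<close> of the sequence then lies in the closure of this subspace and is not distinguished from
  \<open>x\<close> by its norming functionals, so \<open>y = x\<close>.\<close>

lemma whitley:
  fixes A :: "nat \<Rightarrow> 'v::real_normed_vector set"
  assumes refl: "reflexive_space TYPE('v)" and A: "\<And>k. A k \<subseteq> cball 0 r"
    and cl: "\<And>k. weak_map x \<in> closure (weak_map ` A k)"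
  obtains a where "\<And>k. a k \<in> A k" "weakly_conv a x"
proof -
  have "\<exists>a\<in>A k. \<forall>d\<in>D. \<bar>blinfun_apply (norming d) a - blinfun_apply (norming d) x\<bar> < 1 / real (Suc k)"
    if D: "finite D" for k D
  proof -
    define O' where "O' = (\<Inter>d\<in>D. {\<Psi>. \<bar>\<Psi> (norming d) - weak_map x (norming d)\<bar> < 1 / real (Suc k)})"
    have "open O'" unfolding O'_def using D by (intro open_INT ballI open_weak_near)
    moreover have "weak_map x \<in> O'" by (auto simp: O'_def)
    ultimately have "O' \<inter> (weak_map ` A k) \<noteq> {}"
      using cl[of k] open_Int_closure_eq_empty by blast
    then obtain a where "a \<in> A k" "weak_map a \<in> O'" by blast
    then show ?thesis by (intro bexI[of _ a]) (auto simp: O'_def weak_map_def)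
  qed
  then have "\<forall>k D. \<exists>a. finite D \<longrightarrow> a \<in> A k \<and>
      (\<forall>d\<in>D. \<bar>blinfun_apply (norming d) a - blinfun_apply (norming d) x\<bar> < 1 / real (Suc k))"
    by blast
  then obtain sel where sel: "\<And>k D. finite D \<Longrightarrow> sel k D \<in> A k"
    "\<And>k D d. finite D \<Longrightarrow> d \<in> D \<Longrightarrow>
       \<bar>blinfun_apply (norming d) (sel k D) - blinfun_apply (norming d) x\<bar> < 1 / real (Suc k)"
    unfolding choice_iff by blast
  define q :: "nat \<Rightarrow> real" where "q j = real_of_rat (nat_to_rat_surj j)" for j
  \<comment> \<open>Stage \<open>k\<close> multiplies only by the rationals of index at most
    \<open>k\<close> and therefore stays finite; the union over all stages still admits every
    rational multiple.\<close>
  define step where "step k D = D \<union> {sel k D} \<union> (\<lambda>(p, p'). p - p') ` (D \<times> D) \<union> (\<lambda>(j, p). q j *\<^sub>R p) ` ({..k} \<times> D)"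
    for k D
  define E where "E = rec_nat {x} step"
  have E0: "E 0 = {x}" and ES: "E (Suc k) = step k (E k)" for k by (auto simp: E_def)
  have fin: "finite (E k)" for k by (induction k) (auto simp: E0 ES step_def)
  have mono: "E i \<subseteq> E j" if "i \<le> j" for i j
    using that by (rule lift_Suc_mono_le[rotated]) (auto simp: ES step_def)
  define a where "a k = sel k (E k)" for k
  define U where "U = (\<Union>k. E k)"
  have aU: "a k \<in> U" for k
  proof -
    have "a k \<in> E (Suc k)" by (simp add: ES step_def a_def)
    then show ?thesis unfolding U_def by blast
  qed
  have xU: "x \<in> U" unfolding U_def using E0 by blast
  have dU: "p - p' \<in> U" if pU: "p \<in> U" "p' \<in> U" for p p'
  proof -
    obtain i j where ij: "p \<in> E i" "p' \<in> E j" using pU unfolding U_def by blast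
    then have "p \<in> E (max i j)" "p' \<in> E (max i j)" using mono[of i "max i j"] mono[of j "max i j"] by auto
    then have "p - p' \<in> E (Suc (max i j))" unfolding ES step_def by force
    then show ?thesis unfolding U_def by blast
  qed
  have sU: "c *\<^sub>R p \<in> U" if cp: "c \<in> \<rat>" "p \<in> U" for c p
  proof -
    obtain i where i: "p \<in> E i" using cp(2) unfolding U_def by blast
    obtain c' where "c = real_of_rat c'" using cp(1) by (rule Rats_cases)
    moreover obtain j where "nat_to_rat_surj j = c'" using surj_nat_to_rat_surj by (metis surjD)
    ultimately have c: "c = q j" by (simp add: q_def)
    have "p \<in> E (max i j)" using i mono[of i "max i j"] by auto
    then have "(\<lambda>(j, p). q j *\<^sub>R p) (j, p) \<in> (\<lambda>(j, p). q j *\<^sub>R p) ` ({..max i j} \<times> E (max i j))"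
      by (intro imageI) auto
    then have "c *\<^sub>R p \<in> E (Suc (max i j))" unfolding ES step_def c by auto
    then show ?thesis unfolding U_def by blast
  qed
  have ab: "norm (a k) \<le> r" for k using sel(1)[OF fin, of k k] A[of k] by (auto simp: a_def)
  have lim: "(\<lambda>k. blinfun_apply (norming d) (a k)) \<longlonglongrightarrow> blinfun_apply (norming d) x" if dU': "d \<in> U" for d
  proof -
    obtain i where i: "d \<in> E i" using dU' unfolding U_def by blast
    have "\<bar>blinfun_apply (norming d) (a k) - blinfun_apply (norming d) x\<bar> \<le> 1 / real (Suc k)" if "k \<ge> i" for k
      using sel(2)[OF fin, of d k k] i mono[OF that] by (auto simp: a_def less_imp_le)
    then have "\<forall>\<^sub>F k in sequentially. norm (blinfun_apply (norming d) (a k) - blinfun_apply (norming d) x) \<le> 1 / real (Suc k)"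
      by (auto simp: eventually_sequentially)
    then have "(\<lambda>k. blinfun_apply (norming d) (a k) - blinfun_apply (norming d) x) \<longlonglongrightarrow> 0"
      by (rule Lim_null_comparison) (use LIMSEQ_inverse_real_of_nat in \<open>simp add: inverse_eq_divide\<close>)
    then show ?thesis by (simp add: LIM_zero_iff)
  qed
  have "weakly_conv a x"
    unfolding weakly_conv_def
  proof (rule allI, rule ccontr)
    fix f :: "'v \<Rightarrow>\<^sub>L real"
    assume "\<not> (\<lambda>n. blinfun_apply f (a n)) \<longlonglongrightarrow> blinfun_apply f x"
    then obtain e where e: "e > 0" "\<exists>\<^sub>F n in sequentially. \<not> dist (blinfun_apply f (a n)) (blinfun_apply f x) < e"
      unfolding tendsto_iff frequently_def by auto
    \<comment> \<open>The indices at which \<open>f\<close> stays at distance \<open>e\<close> from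
      its expected limit. A cluster point along this filter turns out to be \<open>x\<close> itself,
      where \<open>f\<close> would have to come close.\<close>
    define G where "G = inf sequentially (principal {n. \<not> dist (blinfun_apply f (a n)) (blinfun_apply f x) < e})"
    have G: "G \<noteq> bot"
      using e(2) unfolding G_def trivial_limit_def eventually_inf_principal frequently_def by simp
    obtain y where y: "\<And>O'. open O' \<Longrightarrow> weak_map y \<in> O' \<Longrightarrow> \<exists>\<^sub>F i in G. weak_map (a i) \<in> O'"
      using weak_cluster_point[OF refl G, of a r] ab by blast
    have yf: "\<exists>\<^sub>F i in G. \<bar>blinfun_apply g (a i) - blinfun_apply g y\<bar> < \<delta>" if "\<delta> > 0" for g :: "'v \<Rightarrow>\<^sub>L real" and \<delta>
      using y[OF open_weak_near[of g "blinfun_apply g y" \<delta>]] that by (simp add: weak_map_def)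
    have yeq: "blinfun_apply (norming d) (y - x) = 0" if "d \<in> U" for d
    proof (rule ccontr)
      assume ne: "blinfun_apply (norming d) (y - x) \<noteq> 0"
      define \<delta> where "\<delta> = \<bar>blinfun_apply (norming d) (y - x)\<bar> / 2"
      have \<delta>: "\<delta> > 0" using ne by (simp add: \<delta>_def)
      have "\<forall>\<^sub>F k in G. \<bar>blinfun_apply (norming d) (a k) - blinfun_apply (norming d) x\<bar> < \<delta>"
        unfolding G_def
        by (rule filter_leD[OF inf_le1]) (use lim[OF that] \<delta> in \<open>auto simp: tendsto_iff dist_real_def\<close>)
      from frequently_eventually_frequently[OF yf[OF \<delta>, of "norming d"] this]
      have "\<exists>\<^sub>F k in G. False"
        by (rule frequently_elim1) (auto simp: \<delta>_def blinfun.diff_right abs_if field_simps split: if_splits)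
      then show False by simp
    qed
    have "y \<in> closure U"
    proof (rule ccontr)
      assume "y \<notin> closure U"
      then obtain g :: "'v \<Rightarrow>\<^sub>L real" and \<delta> where g: "\<delta> > 0" "\<And>w. w \<in> closure U \<Longrightarrow> blinfun_apply g y + \<delta> \<le> blinfun_apply g w"
        using separate_point_closed_convex[OF closed_closure convex_closure_rational_subspace[OF dU sU]] by blast
      have "\<exists>\<^sub>F k in G. False"
        using yf[OF g(1), of g]
      proof (rule frequently_elim1)
        fix k assume "\<bar>blinfun_apply g (a k) - blinfun_apply g y\<bar> < \<delta>"
        with g(2)[of "a k"] aU[of k] closure_subset[of U] show False by force
      qed
      then show False by simp
    qed
    then have "y - x \<in> closure U"
      using xU closure_subset[of U] by (intro closure_differences dU) auto
    then have "y = x" using norming_separates_closure[of "y - x" U] yeq by simp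
    have "\<forall>\<^sub>F k in G. \<not> dist (blinfun_apply f (a k)) (blinfun_apply f x) < e"
      unfolding G_def eventually_inf_principal by simp
    from frequently_eventually_frequently[OF yf[OF e(1), of f] this]
    show False by (simp add: \<open>y = x\<close> dist_real_def)
  qed
  moreover have "a k \<in> A k" for k using sel(1)[OF fin] by (simp add: a_def)
  ultimately show ?thesis using that by blast
qed

text \<open>With the \<open>k\<close>-th tail as \<open>A k\<close>, the selected sequence consists
  of terms \<open>xs (n k)\<close> with \<open>n k \<ge> k\<close>.\<close>

lemma bounded_weakly_conv_subseq:
  fixes xs :: "nat \<Rightarrow> 'v::real_normed_vector"
  assumes refl: "reflexive_space TYPE('v)" and b: "\<And>n. norm (xs n) \<le> r"
  obtains s x where "strict_mono s" "weakly_conv (xs \<circ> s) x"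
proof -
  obtain x where x: "\<And>U. open U \<Longrightarrow> weak_map x \<in> U \<Longrightarrow> \<exists>\<^sub>F n in sequentially. weak_map (xs n) \<in> U"
    using weak_cluster_point[OF refl sequentially_bot, of xs r] b by blast
  have "weak_map x \<in> closure (weak_map ` (xs ` {k..}))" for k
  proof -
    have "U \<inter> (weak_map ` (xs ` {k..})) \<noteq> {}" if "open U" "weak_map x \<in> U" for U
      using x[OF that] unfolding frequently_sequentially by fast
    then show ?thesis
      unfolding closure_iff_nhds_not_empty by blast
  qed
  moreover have "xs ` {k..} \<subseteq> cball 0 r" for k using b by auto
  ultimately obtain a where a: "\<And>k. a k \<in> xs ` {k..}" "weakly_conv a x"
    using whitley[OF refl, of "\<lambda>k. xs ` {k..}" r x] by blast
  have "\<forall>k. \<exists>n. n \<ge> k \<and> a k = xs n" using a(1) by (meson atLeast_iff imageE)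
  then obtain n where n: "\<And>k. n k \<ge> k" "\<And>k. a k = xs (n k)" unfolding choice_iff by blast
  \<comment> \<open>\<open>n\<close> need not increase; iterating its successor from 0 makes
    \<open>n \<circ> s\<close> strictly increasing.\<close>
  define s where "s = rec_nat 0 (\<lambda>_ k. Suc (n k))"
  have s: "s (Suc j) = Suc (n (s j))" for j by (simp add: s_def)
  have ms: "strict_mono s" using n(1) by (intro strict_monoI_Suc) (simp add: s le_imp_less_Suc)
  have mn: "strict_mono (n \<circ> s)"
  proof (rule strict_monoI_Suc)
    show "(n \<circ> s) j < (n \<circ> s) (Suc j)" for j using n(1)[of "s (Suc j)"] by (simp add: s)
  qed
  have "xs \<circ> (n \<circ> s) = a \<circ> s" using n(2) by (simp add: fun_eq_iff)
  then have "weakly_conv (xs \<circ> (n \<circ> s)) x" using weakly_conv_subseq[OF a(2) ms] by simp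
  with mn show ?thesis by (rule that)
qed

definition weakly_seq_closed :: "'v::real_normed_vector set \<Rightarrow> bool" where
  "weakly_seq_closed S \<longleftrightarrow> (\<forall>xs x. (\<forall>n. xs n \<in> S) \<longrightarrow> weakly_conv xs x \<longrightarrow> x \<in> S)"

lemma weakly_seq_closedI:
  "(\<And>xs x. (\<And>n. xs n \<in> S) \<Longrightarrow> weakly_conv xs x \<Longrightarrow> x \<in> S) \<Longrightarrow> weakly_seq_closed S"
  by (auto simp: weakly_seq_closed_def)

text \<open>Whitley's construction for the constant family turns a point of the weak closure into
  the limit of a sequence in \<open>S\<close>. Boundedness enters beforehand: the image of the ball
  is closed, so every point of the closure has the form \<open>weak_map x\<close>.\<close>

lemma weak_map_weakly_seq_closed:
  fixes S :: "'v::real_normed_vector set"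
  assumes refl: "reflexive_space TYPE('v)" and S: "S \<subseteq> cball 0 r" "weakly_seq_closed S"
  shows "closed (weak_map ` S)" "compact (weak_map ` S)"
proof -
  show cl: "closed (weak_map ` S)"
  proof (cases "S = {}")
    case False
    then have r: "r \<ge> 0" using S(1) order_trans[OF norm_ge_zero] by fastforce
    have "closure (weak_map ` S) \<subseteq> weak_map ` S"
    proof
      fix \<Phi> assume \<Phi>: "\<Phi> \<in> closure (weak_map ` S)"
      then have "\<Phi> \<in> weak_map ` cball (0::'v) r"
        using closure_minimal[OF image_mono[OF S(1)] weak_map_cball(2)[OF refl r]] by blast
      then obtain x where x: "\<Phi> = weak_map x" by blast
      obtain a where "\<And>k. a k \<in> S" "weakly_conv a x"
        using whitley[OF refl, of "\<lambda>_. S" r x] S(1) \<Phi> x by blast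
      then show "\<Phi> \<in> weak_map ` S" using S(2) x by (auto simp: weakly_seq_closed_def)
    qed
    then show ?thesis by (metis closure_subset_eq)
  qed simp
  show "compact (weak_map ` S)"
  proof (cases "S = {}")
    case False
    then have r: "r \<ge> 0" using S(1) order_trans[OF norm_ge_zero] by fastforce
    have "weak_map ` S = weak_map ` cball 0 r \<inter> weak_map ` S" using S(1) by blast
    then show ?thesis using compact_Int_closed[OF weak_map_cball(1)[OF refl r] cl] by simp
  qed simp
qed

section \<open>Ky Fan's inequality\<close>

lemma tendsto_funD:
  fixes f :: "'a \<Rightarrow> 'i \<Rightarrow> 'b::topological_space"
  assumes "(f \<longlongrightarrow> l) F"
  shows "((\<lambda>n. f n i) \<longlongrightarrow> l i) F"
  by (rule continuous_on_tendsto_compose[OF continuous_on_product_coordinates assms]) auto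

text \<open>The dimension is a term and not a type, because it is known only as the size of a finite
  set inside a later proof.\<close>

definition unit_cube :: "nat \<Rightarrow> (nat \<Rightarrow> real) set" where
  "unit_cube n = {x. (\<forall>i. 0 \<le> x i \<and> x i \<le> 1) \<and> (\<forall>i\<ge>n. x i = 0)}"

lemma compact_unit_cube: "compact (unit_cube n)"
proof -
  have "compactin (product_topology (\<lambda>i. euclidean) UNIV)
      (\<Pi>\<^sub>E i\<in>(UNIV :: nat set). if i < n then {0..1::real} else {0})"
    unfolding compactin_PiE by auto
  moreover have "(\<Pi>\<^sub>E i\<in>(UNIV :: nat set). if i < n then {0..1::real} else {0}) = unit_cube n"
    by (auto simp: unit_cube_def PiE_iff not_less split: if_splits) (metis not_le order_refl zero_le_one)+
  ultimately show ?thesis by (simp add: euclidean_product_topology)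
qed

text \<open>Kuhn's combinatorial lemma on the grid of mesh \<open>1 / p\<close>, with label 1 where
  \<open>f\<close> moves the \<open>i\<close>-th coordinate down. Two labels in one cell give both
  inequalities between \<open>f\<close> and the identity in that coordinate, though at different
  corners.\<close>

lemma kuhn_grid_cell:
  fixes f :: "(nat \<Rightarrow> real) \<Rightarrow> nat \<Rightarrow> real"
  assumes f: "f \<in> unit_cube n \<rightarrow> unit_cube n" and p: "p > 0"
  defines "g \<equiv> \<lambda>(x :: nat \<Rightarrow> nat) i. if i < n then real (x i) / real p else 0"
  obtains q where "\<forall>i<n. q i < p"
    "\<forall>i<n. \<exists>r s. (\<forall>j<n. q j \<le> r j \<and> r j \<le> q j + 1) \<and> (\<forall>j<n. q j \<le> s j \<and> s j \<le> q j + 1) \<and>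
       g r i \<le> f (g r) i \<and> f (g s) i \<le> g s i"
proof -
  \<comment> \<open>On the faces the label is forced, 0 at \<open>x i = 0\<close> and 1 at
    \<open>x i = p\<close>, as Kuhn's lemma demands. Since \<open>f\<close> stays in the cube, the
    inequalities read off from the labels remain true there.\<close>
  define label :: "(nat \<Rightarrow> nat) \<Rightarrow> nat \<Rightarrow> nat"
    where "label x i = (if x i = p \<or> x i \<noteq> 0 \<and> f (g x) i < g x i then 1 else 0)" for x i
  have g_cube: "g x \<in> unit_cube n" if "\<forall>i<n. x i \<le> p" for x
    using that p by (auto simp: g_def unit_cube_def)
  have fg: "0 \<le> f (g x) i" "f (g x) i \<le> 1" if "\<forall>i<n. x i \<le> p" for x i
    using f g_cube[OF that] by (auto simp: unit_cube_def Pi_iff)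
  obtain q where q: "\<forall>i<n. q i < p"
    "\<forall>i<n. \<exists>r s. (\<forall>j<n. q j \<le> r j \<and> r j \<le> q j + 1) \<and> (\<forall>j<n. q j \<le> s j \<and> s j \<le> q j + 1) \<and> label r i \<noteq> label s i"
    by (rule kuhn_lemma[OF p, of n label]) (use p in \<open>auto simp: label_def\<close>)
  have le_p: "\<forall>j<n. r j \<le> p" if "\<forall>j<n. q j \<le> r j \<and> r j \<le> q j + 1" for r
    using that q(1) by fastforce
  have zero: "g r i \<le> f (g r) i" if "\<forall>j<n. r j \<le> p" "label r i = 0" "i < n" for r i
    using that fg[OF that(1), of i] by (auto simp: label_def g_def split: if_splits)
  have one: "f (g s) i \<le> g s i" if "\<forall>j<n. s j \<le> p" "label s i = 1" "i < n" for s i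
    using that fg[OF that(1), of i] p by (auto simp: label_def g_def split: if_splits)
  have lab: "label x i = 0 \<or> label x i = 1" for x i by (simp add: label_def)
  show ?thesis
  proof (rule that[OF q(1)], intro allI impI)
    fix i assume i: "i < n"
    then obtain r s where rs: "\<forall>j<n. q j \<le> r j \<and> r j \<le> q j + 1" "\<forall>j<n. q j \<le> s j \<and> s j \<le> q j + 1"
      "label r i \<noteq> label s i" using q(2) by blast
    from lab[of r i] lab[of s i] rs(3)
    consider "label r i = 0" "label s i = 1" | "label s i = 0" "label r i = 1" by auto
    then show "\<exists>r s. (\<forall>j<n. q j \<le> r j \<and> r j \<le> q j + 1) \<and> (\<forall>j<n. q j \<le> s j \<and> s j \<le> q j + 1) \<and>
       g r i \<le> f (g r) i \<and> f (g s) i \<le> g s i"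
    proof cases
      case 1
      with rs(1,2) show ?thesis
        using zero[OF le_p[OF rs(1)] _ i] one[OF le_p[OF rs(2)] _ i] by (intro exI[of _ r] exI[of _ s]) simp
    next
      case 2
      with rs(1,2) show ?thesis
        using zero[OF le_p[OF rs(2)] _ i] one[OF le_p[OF rs(1)] _ i] by (intro exI[of _ s] exI[of _ r]) simp
    qed
  qed
qed

text \<open>Along a subsequence, all corners of the shrinking cells tend to one limit
  \<open>c\<close>, so the opposite inequalities seen at different corners hold together at
  \<open>c\<close> in every coordinate.\<close>

theorem brouwer_unit_cube:
  fixes f :: "(nat \<Rightarrow> real) \<Rightarrow> nat \<Rightarrow> real"
  assumes cont: "continuous_on (unit_cube n) f" and f: "f \<in> unit_cube n \<rightarrow> unit_cube n"
  obtains x where "x \<in> unit_cube n" "f x = x"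
proof -
  define g :: "nat \<Rightarrow> (nat \<Rightarrow> nat) \<Rightarrow> nat \<Rightarrow> real"
    where "g p = (\<lambda>x i. if i < n then real (x i) / real p else 0)" for p
  define near :: "(nat \<Rightarrow> nat) \<Rightarrow> (nat \<Rightarrow> nat) \<Rightarrow> bool"
    where "near q r \<longleftrightarrow> (\<forall>j<n. q j \<le> r j \<and> r j \<le> q j + 1)" for q r
  have "\<exists>q. (\<forall>i<n. q i < Suc k) \<and> (\<forall>i<n. \<exists>r s. near q r \<and> near q s \<and>
       g (Suc k) r i \<le> f (g (Suc k) r) i \<and> f (g (Suc k) s) i \<le> g (Suc k) s i)" for k
    by (rule kuhn_grid_cell[OF f, of "Suc k"]) (auto simp: g_def near_def)
  then obtain q where q: "\<And>k i. i < n \<Longrightarrow> q k i < Suc k"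
    "\<And>k i. i < n \<Longrightarrow> \<exists>r s. near (q k) r \<and> near (q k) s \<and>
       g (Suc k) r i \<le> f (g (Suc k) r) i \<and> f (g (Suc k) s) i \<le> g (Suc k) s i"
    by metis
  then have "\<forall>k i. \<exists>r s. i < n \<longrightarrow> near (q k) r \<and> near (q k) s \<and>
       g (Suc k) r i \<le> f (g (Suc k) r) i \<and> f (g (Suc k) s) i \<le> g (Suc k) s i"
    by blast
  then obtain r s where rs: "\<And>k i. i < n \<Longrightarrow> near (q k) (r k i)" "\<And>k i. i < n \<Longrightarrow> near (q k) (s k i)"
    "\<And>k i. i < n \<Longrightarrow> g (Suc k) (r k i) i \<le> f (g (Suc k) (r k i)) i"
    "\<And>k i. i < n \<Longrightarrow> f (g (Suc k) (s k i)) i \<le> g (Suc k) (s k i) i"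
    unfolding choice_iff by blast
  have near_cube: "g (Suc k) x \<in> unit_cube n" if "near (q k) x" for k x
  proof -
    have "x j \<le> Suc k" if "j < n" for j
      using \<open>near (q k) x\<close> q(1)[OF that, of k] that unfolding near_def by fastforce
    then have "real (x j) \<le> real (Suc k)" if "j < n" for j using that by (simp only: of_nat_le_iff)
    then show ?thesis by (auto simp: g_def unit_cube_def)
  qed
  define X where "X k = g (Suc k) (q k)" for k
  have X: "X k \<in> unit_cube n" for k unfolding X_def by (rule near_cube) (simp add: near_def)
  obtain c \<sigma> where c: "c \<in> unit_cube n" "strict_mono (\<sigma> :: nat \<Rightarrow> nat)" "(X \<circ> \<sigma>) \<longlonglongrightarrow> c"
    by (rule seq_compactE[OF compact_imp_seq_compact[OF compact_unit_cube], of X n]) (use X in auto)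
  have lim: "(\<lambda>k. g (Suc (\<sigma> k)) (x k)) \<longlonglongrightarrow> c" if x: "\<And>k. near (q (\<sigma> k)) (x k)" for x
  proof (rule tendsto_funI)
    fix j
    have Xj: "(\<lambda>k. X (\<sigma> k) j) \<longlonglongrightarrow> c j" using tendsto_funD[OF c(3), of j] by simp
    have "(\<lambda>k. g (Suc (\<sigma> k)) (x k) j - X (\<sigma> k) j) \<longlonglongrightarrow> 0"
    proof (rule Lim_null_comparison)
      show "\<forall>\<^sub>F k in sequentially. norm (g (Suc (\<sigma> k)) (x k) j - X (\<sigma> k) j) \<le> 1 / real (Suc (\<sigma> k))"
      proof (intro always_eventually allI)
        fix k
        show "norm (g (Suc (\<sigma> k)) (x k) j - X (\<sigma> k) j) \<le> 1 / real (Suc (\<sigma> k))"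
        proof (cases "j < n")
          case True
          then have "q (\<sigma> k) j \<le> x k j" "x k j \<le> q (\<sigma> k) j + 1" using x[of k] by (auto simp: near_def)
          then have "\<bar>real (x k j) - real (q (\<sigma> k) j)\<bar> \<le> 1" by auto
          then have "\<bar>real (x k j) - real (q (\<sigma> k) j)\<bar> / real (Suc (\<sigma> k)) \<le> 1 / real (Suc (\<sigma> k))"
            by (intro divide_right_mono) auto
          then show ?thesis using True by (simp add: g_def X_def flip: diff_divide_distrib)
        qed (simp add: g_def X_def)
      qed
      show "(\<lambda>k. 1 / real (Suc (\<sigma> k))) \<longlonglongrightarrow> 0"
        using LIMSEQ_subseq_LIMSEQ[OF LIMSEQ_inverse_real_of_nat c(2)] by (simp add: comp_def inverse_eq_divide)
    qed
    from tendsto_add[OF this Xj] show "(\<lambda>k. g (Suc (\<sigma> k)) (x k) j) \<longlonglongrightarrow> c j" by simp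
  qed
  have flim: "(\<lambda>k. f (g (Suc (\<sigma> k)) (x k)) i) \<longlonglongrightarrow> f c i" if x: "\<And>k. near (q (\<sigma> k)) (x k)" for x i
    by (rule tendsto_funD[OF continuous_on_tendsto_compose[OF cont lim[OF x] c(1)]])
      (use near_cube[OF x] in auto)
  have "f c i = c i" for i
  proof (cases "i < n")
    case True
    note r = rs(1)[OF True, of "\<sigma> _"] and s = rs(2)[OF True, of "\<sigma> _"]
    have "c i \<le> f c i"
      by (rule LIMSEQ_le[OF tendsto_funD[OF lim[OF r]] flim[OF r]]) (use rs(3)[OF True] in auto)
    moreover have "f c i \<le> c i"
      by (rule LIMSEQ_le[OF flim[OF s] tendsto_funD[OF lim[OF s]]]) (use rs(4)[OF True] in auto)
    ultimately show ?thesis by simp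
  next
    case False
    then show ?thesis using f c(1) by (auto simp: unit_cube_def Pi_iff)
  qed
  then show ?thesis using that[OF c(1)] by auto
qed

section \<open>Nonnegative values at a point of the simplex\<close>

definition weights :: "nat \<Rightarrow> (nat \<Rightarrow> real) set" where
  "weights n = {c. (\<forall>i. 0 \<le> c i) \<and> (\<forall>i\<ge>n. c i = 0) \<and> (\<Sum>i<n. c i) = 1}"

lemma weights_subset_unit_cube: "weights n \<subseteq> unit_cube n"
proof
  fix c assume c: "c \<in> weights n"
  have "c i \<le> 1" for i
  proof (cases "i < n")
    case True
    then have "c i \<le> (\<Sum>i<n. c i)" using c by (intro member_le_sum) (auto simp: weights_def)
    then show ?thesis using c by (simp add: weights_def)
  next
    case False
    then show ?thesis using c by (simp add: weights_def)
  qed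
  then show "c \<in> unit_cube n" using c by (auto simp: weights_def unit_cube_def)
qed

text \<open>A fixed point of Nash's map \<open>h\<close>, which raises the weights of the indices with \<open>g j c < 0\<close>; the
  retraction \<open>\<rho>\<close> of the cube onto the simplex makes Brouwer's theorem for the cube applicable.\<close>

lemma ex_weights_nonneg:
  fixes g :: "nat \<Rightarrow> (nat \<Rightarrow> real) \<Rightarrow> real"
  assumes n: "n > 0" and cont: "\<And>j. j < n \<Longrightarrow> continuous_on (weights n) (g j)"
    and avg: "\<And>c. c \<in> weights n \<Longrightarrow> 0 \<le> (\<Sum>j<n. c j * g j c)"
  obtains c where "c \<in> weights n" "\<And>j. j < n \<Longrightarrow> 0 \<le> g j c"
proof -
  \<comment> \<open>Missing mass is spread evenly over the \<open>n\<close> coordinates and excess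
    mass is divided away. At most one of the two corrections is active, and neither is on the
    simplex.\<close>
  define \<rho> where "\<rho> c = (\<lambda>i. if i < n then (c i + max 0 (1 - (\<Sum>i<n. c i)) / n) / max 1 (\<Sum>i<n. c i) else 0)"
    for c :: "nat \<Rightarrow> real"
  have \<rho>: "\<rho> c \<in> weights n" if "c \<in> unit_cube n" for c
  proof -
    have "(\<Sum>i<n. \<rho> c i) = ((\<Sum>i<n. c i) + max 0 (1 - (\<Sum>i<n. c i))) / max 1 (\<Sum>i<n. c i)"
      using n by (simp add: \<rho>_def sum.distrib flip: sum_divide_distrib)
    also have "\<dots> = 1" by (auto simp: max_def)
    finally show ?thesis using that by (auto simp: weights_def unit_cube_def \<rho>_def)
  qed
  have \<rho>_fix: "\<rho> c = c" if "c \<in> weights n" for c using that by (auto simp: \<rho>_def weights_def)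
  have \<rho>_cont: "continuous_on (unit_cube n) \<rho>"
  proof (rule continuous_on_coordinatewise_then_product)
    have co: "continuous_on (unit_cube n) (\<lambda>c. c j)" for j
      by (rule continuous_on_subset[OF continuous_on_product_coordinates]) simp
    show "continuous_on (unit_cube n) (\<lambda>c. \<rho> c i)" for i
    proof (cases "i < n")
      case True
      have nz: "max 1 (\<Sum>i<n. c i) \<noteq> 0" for c :: "nat \<Rightarrow> real" by (simp add: max_def)
      show ?thesis
        unfolding \<rho>_def using True nz by (simp del: max_less_iff_conj) (intro continuous_intros co ballI nz; simp)
    qed (simp add: \<rho>_def)
  qed
  define m where "m j c = max 0 (- g j (\<rho> c))" for j c
  define M where "M c = (\<Sum>j<n. m j c)" for c
  define h where "h c = (\<lambda>i. if i < n then (\<rho> c i + m i c) / (1 + M c) else 0)" for c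
  have m0: "0 \<le> m j c" and M0: "0 \<le> M c" for j c by (auto simp: m_def M_def intro: sum_nonneg)
  have m_cont: "continuous_on (unit_cube n) (m j)" if "j < n" for j
    unfolding m_def
    by (intro continuous_intros continuous_on_compose2[OF cont[OF that] \<rho>_cont]) (use \<rho> in auto)
  have M_cont: "continuous_on (unit_cube n) M"
    unfolding M_def by (intro continuous_intros m_cont) auto
  have h_cont: "continuous_on (unit_cube n) h"
  proof (rule continuous_on_coordinatewise_then_product)
    have nz: "1 + M c \<noteq> 0" for c using M0[of c] by linarith
    show "continuous_on (unit_cube n) (\<lambda>c. h c i)" for i
      unfolding h_def
      by (cases "i < n")
        (auto intro!: continuous_intros m_cont M_cont continuous_on_product_then_coordinatewise[OF \<rho>_cont] simp: nz)
  qed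
  have h: "h c \<in> weights n" if "c \<in> unit_cube n" for c
  proof -
    have "(\<Sum>i<n. h c i) = ((\<Sum>i<n. \<rho> c i) + M c) / (1 + M c)"
      by (simp add: h_def M_def sum.distrib flip: sum_divide_distrib)
    also have "\<dots> = 1" using \<rho>[OF that] M0[of c] by (simp add: weights_def)
    finally show ?thesis using \<rho>[OF that] m0 M0[of c] by (auto simp: weights_def h_def)
  qed
  obtain c where c: "c \<in> unit_cube n" "h c = c"
    using brouwer_unit_cube[OF h_cont] h weights_subset_unit_cube by blast
  then have cw: "c \<in> weights n" using h by metis
  have eq: "c i * M c = m i c" if "i < n" for i
  proof -
    have "c i = (c i + m i c) / (1 + M c)"
      using fun_cong[OF c(2), of i] that \<rho>_fix[OF cw] by (simp add: h_def)
    then show ?thesis using M0[of c] by (simp add: field_simps)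
  qed
  have mz: "m i c = max 0 (- g i c)" for i by (simp add: m_def \<rho>_fix[OF cw])
  have "M c = 0"
  proof (rule ccontr)
    assume "M c \<noteq> 0"
    with M0 have M: "M c > 0" by (simp add: less_le)
    \<comment> \<open>At the fixed point \<open>c j * M c\<close> equals \<open>m j c\<close>, the
      negative part of \<open>g j c\<close>. Each summand of the average becomes minus a square
      after multiplication by \<open>M c\<close>, so a nonnegative average forces all squares to
      vanish.\<close>
    have sq: "c j * g j c * M c = - (m j c)\<^sup>2" if "j < n" for j
    proof -
      have "c j * g j c * M c = m j c * g j c" unfolding eq[OF that, symmetric] by simp
      also have "\<dots> = - (m j c)\<^sup>2" unfolding mz by (simp add: max_def power2_eq_square)
      finally show ?thesis .
    qed
    have "0 \<le> (\<Sum>j<n. c j * g j c) * M c" using avg[OF cw] M by simp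
    also have "\<dots> = - (\<Sum>j<n. (m j c)\<^sup>2)" using sq by (simp add: sum_distrib_right flip: sum_negf)
    finally have le: "(\<Sum>j<n. (m j c)\<^sup>2) \<le> 0" by simp
    have "m j c = 0" if "j < n" for j
    proof -
      have "(m j c)\<^sup>2 \<le> (\<Sum>j<n. (m j c)\<^sup>2)" using that by (intro member_le_sum) auto
      with le show ?thesis by (smt (verit) zero_le_power2 power2_eq_iff_nonneg power_zero_numeral m0)
    qed
    then have "M c = 0" by (simp add: M_def)
    with M show False by simp
  qed
  then have "m j c = 0" if "j < n" for j using eq[OF that] by simp
  then have "0 \<le> g j c" if "j < n" for j using mz[of j] that by (auto simp: max_def split: if_splits)
  with cw show ?thesis by (rule that)
qed

section \<open>Ky Fan's inequality in the weak topology\<close>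

lemma inj_weak_map: "inj weak_map"
proof (rule injI)
  fix x y :: 'a assume *: "weak_map x = weak_map y"
  obtain f :: "'a \<Rightarrow>\<^sub>L real" where "blinfun_apply f (x - y) = norm (x - y)" using norming_functional by blast
  with fun_cong[OF *, of f] show "x = y" by (simp add: weak_map_def blinfun.diff_right)
qed

text \<open>The superlevel sets have closed images in the compact image of the ball, so it suffices
  to treat finitely many test points; for these the problem lives on a simplex of weights, where
  norm continuity is enough. The averaging hypothesis stands in for convexity in the second argument
  with a sign on the diagonal: Minty's function need not be convex there but has this property,
  which survives sums with nonnegative coefficients depending on \<open>u\<close>.\<close>

theorem ky_fan_weak:
  fixes X :: "'v::real_normed_vector set" and \<Psi> :: "'v \<Rightarrow> 'v \<Rightarrow> real"
  assumes refl: "reflexive_space TYPE('v)" and X: "X \<noteq> {}" "X \<subseteq> cball 0 r" "convex X"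
    and closed: "\<And>v. v \<in> X \<Longrightarrow> weakly_seq_closed {u \<in> X. 0 \<le> \<Psi> u v}"
    and cont: "\<And>v. v \<in> X \<Longrightarrow> continuous_on X (\<lambda>u. \<Psi> u v)"
    and avg: "\<And>n c v. c \<in> weights n \<Longrightarrow> (\<And>i. i < n \<Longrightarrow> v i \<in> X) \<Longrightarrow>
                0 \<le> (\<Sum>j<n. c j * \<Psi> (\<Sum>i<n. c i *\<^sub>R v i) (v j))"
  obtains u where "u \<in> X" "\<And>v. v \<in> X \<Longrightarrow> 0 \<le> \<Psi> u v"
proof -
  define G where "G v = {u \<in> X. 0 \<le> \<Psi> u v}" for v
  have "r \<ge> 0" using X(1,2) order_trans[OF norm_ge_zero] by fastforce
  have "weak_map ` cball 0 r \<inter> (\<Inter>v\<in>X. weak_map ` G v) \<noteq> {}"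
  proof (rule compact_imp_fip_image[OF weak_map_cball(1)[OF refl \<open>r \<ge> 0\<close>]])
    show "closed (weak_map ` G v)" if "v \<in> X" for v
      by (rule weak_map_weakly_seq_closed(1)[OF refl _ closed[OF that, folded G_def]]) (use X(2) in \<open>auto simp: G_def\<close>)
    fix V assume V: "finite V" "V \<subseteq> X"
    have "\<exists>u\<in>X. \<forall>v\<in>V. 0 \<le> \<Psi> u v"
    proof (cases "V = {}")
      case True
      then show ?thesis using X(1) by blast
    next
      case False
      obtain w where w: "bij_betw w {..<card V} V" using V(1) by (metis atLeast0LessThan ex_bij_betw_nat_finite)
      then have wX: "w i \<in> X" if "i < card V" for i using that V(2) by (auto simp: bij_betw_def)
      have comb: "(\<Sum>i<card V. c i *\<^sub>R w i) \<in> X" if "c \<in> weights (card V)" for c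
        using that wX by (intro convex_sum[OF _ X(3)]) (auto simp: weights_def)
      obtain c where c: "c \<in> weights (card V)" "\<And>j. j < card V \<Longrightarrow> 0 \<le> \<Psi> (\<Sum>i<card V. c i *\<^sub>R w i) (w j)"
      proof (rule ex_weights_nonneg[of "card V" "\<lambda>j c. \<Psi> (\<Sum>i<card V. c i *\<^sub>R w i) (w j)"])
        show "0 < card V" using V False by (simp add: card_gt_0_iff)
        have co: "continuous_on (weights (card V)) (\<lambda>c. c j)" for j
          by (rule continuous_on_subset[OF continuous_on_product_coordinates]) simp
        show "continuous_on (weights (card V)) (\<lambda>c. \<Psi> (\<Sum>i<card V. c i *\<^sub>R w i) (w j))" if "j < card V" for j
          by (rule continuous_on_compose2[OF cont[OF wX[OF that]]]) (use comb in \<open>auto intro!: continuous_intros co\<close>)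
      qed (use avg wX in blast)+
      show ?thesis
      proof (intro bexI ballI)
        show "(\<Sum>i<card V. c i *\<^sub>R w i) \<in> X" by (rule comb[OF c(1)])
        fix v assume "v \<in> V"
        then obtain j where "j < card V" "v = w j" using w by (auto simp: bij_betw_def)
        then show "0 \<le> \<Psi> (\<Sum>i<card V. c i *\<^sub>R w i) v" using c(2) by simp
      qed
    qed
    then obtain u where "u \<in> X" "\<forall>v\<in>V. 0 \<le> \<Psi> u v" by blast
    then have "weak_map u \<in> weak_map ` cball 0 r \<inter> (\<Inter>v\<in>V. weak_map ` G v)"
      using X(2) by (auto simp: G_def)
    then show "weak_map ` cball 0 r \<inter> (\<Inter>v\<in>V. weak_map ` G v) \<noteq> {}" by blast
  qed
  then obtain u where u: "\<And>v. v \<in> X \<Longrightarrow> weak_map u \<in> weak_map ` G v" by blast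
  have "u \<in> G v" if "v \<in> X" for v using u[OF that] inj_weak_map by (auto dest: injD)
  then show ?thesis using X(1) that by (auto simp: G_def)
qed

section \<open>Continuity of convex functions\<close>

lemma ereal_convexD:
  "ereal_convex \<phi> \<Longrightarrow> 0 \<le> t \<Longrightarrow> t \<le> 1 \<Longrightarrow>
    \<phi> ((1 - t) *\<^sub>R x + t *\<^sub>R y) \<le> ereal (1 - t) * \<phi> x + ereal t * \<phi> y"
  by (auto simp: ereal_convex_def)

lemma ereal_proper_edom: "ereal_proper \<phi> \<Longrightarrow> x \<in> edom \<phi> \<Longrightarrow> \<phi> x = ereal (real_of_ereal (\<phi> x))"
  by (cases "\<phi> x") (auto simp: ereal_proper_def edom_def)

lemma closed_ereal_lsc_sublevel:
  assumes "ereal_lsc \<phi>"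
  shows "closed {x. \<phi> x \<le> c}"
  unfolding closed_sequential_limits
proof (intro allI impI, elim conjE)
  fix xs l assume "\<forall>n. xs n \<in> {x. \<phi> x \<le> c}" "xs \<longlonglongrightarrow> l"
  then have "\<phi> l \<le> liminf (\<lambda>n. \<phi> (xs n))" "liminf (\<lambda>n. \<phi> (xs n)) \<le> liminf (\<lambda>n. c)"
    using assms by (auto simp: ereal_lsc_def intro!: Liminf_mono)
  then show "l \<in> {x. \<phi> x \<le> c}" by (simp add: Liminf_const)
qed

text \<open>The closed sublevel sets cover a neighbourhood of \<open>x0\<close>, so by Baire's
  theorem \<open>\<phi>\<close> is bounded above on some ball. That ball may lie away from
  \<open>x0\<close>; convexity carries the bound over.\<close>

lemma convex_lsc_locally_bounded_above:
  fixes \<phi> :: "'v::banach \<Rightarrow> ereal"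
  assumes phi: "ereal_proper \<phi>" "ereal_convex \<phi>" "ereal_lsc \<phi>" and x0: "x0 \<in> interior (edom \<phi>)"
  obtains \<delta> M where "\<delta> > 0" "\<And>y. dist x0 y < \<delta> \<Longrightarrow> \<phi> y \<le> ereal M"
proof -
  obtain \<rho> where \<rho>: "\<rho> > 0" "cball x0 \<rho> \<subseteq> edom \<phi>" using x0 by (meson mem_interior_cball)
  define E where "E n = cball x0 \<rho> \<inter> {y. \<phi> y \<le> ereal (real n)}" for n :: nat
  have clE: "closed (E n)" for n
    unfolding E_def by (intro closed_Int closed_cball closed_ereal_lsc_sublevel phi)
  have "ball x0 \<rho> \<subseteq> \<Union>(range E)"
  proof
    fix y assume y: "y \<in> ball x0 \<rho>"
    then have "\<phi> y = ereal (real_of_ereal (\<phi> y))" using \<rho> by (intro ereal_proper_edom phi) auto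
    moreover obtain n where "real_of_ereal (\<phi> y) \<le> real n" using real_arch_simple by blast
    ultimately have "\<phi> y \<le> ereal (real n)" by (metis ereal_less_eq(3))
    then show "y \<in> \<Union>(range E)" using y by (auto simp: E_def)
  qed
  then have "interior (\<Union>(range E)) \<noteq> {}"
    using \<rho>(1) interior_mono[of "ball x0 \<rho>"] by (metis centre_in_ball empty_iff interior_ball subsetD)
  moreover have "interior (\<Union>(range E)) = {}" if "\<And>n. interior (E n) = {}"
    using Met_TC.metric_Baire_category_alt[where ?'a = 'v and \<G> = "range E"] clE that complete_UNIV
    by auto
  ultimately obtain n where "interior (E n) \<noteq> {}" by blast
  then obtain y0 s where s: "s > 0" "ball y0 s \<subseteq> E n" by (meson ex_in_conv mem_interior)
  \<comment> \<open>The reflection of \<open>y0\<close> through \<open>x0\<close>. A point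
    \<open>y\<close> near \<open>x0\<close> is the midpoint of \<open>z\<close> and
    \<open>2 *\<^sub>R y - z\<close>, and the latter is near \<open>y0\<close>.\<close>
  define z where "z = 2 *\<^sub>R x0 - y0"
  have "y0 \<in> E n" using s by auto
  then have "z \<in> cball x0 \<rho>" by (simp add: E_def z_def dist_norm scaleR_2 norm_minus_commute)
  then have z: "\<phi> z = ereal (real_of_ereal (\<phi> z))" using \<rho> by (intro ereal_proper_edom phi) auto
  show ?thesis
  proof (rule that[of "s / 2"])
    show "s / 2 > 0" using s by simp
    fix y assume y: "dist x0 y < s / 2"
    have "y0 - (2 *\<^sub>R y - z) = 2 *\<^sub>R (x0 - y)" by (simp add: z_def scaleR_2 algebra_simps)
    then have "dist y0 (2 *\<^sub>R y - z) < s" using y by (simp add: dist_norm)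
    then have "\<phi> (2 *\<^sub>R y - z) \<le> ereal (real n)" using s by (auto simp: E_def)
    then have "ereal (1/2) * \<phi> (2 *\<^sub>R y - z) \<le> ereal (1/2) * ereal (real n)"
      by (intro ereal_mult_left_mono) auto
    moreover have "\<phi> ((1 - 1/2) *\<^sub>R z + (1/2) *\<^sub>R (2 *\<^sub>R y - z)) \<le> ereal (1 - 1/2) * \<phi> z + ereal (1/2) * \<phi> (2 *\<^sub>R y - z)"
      by (rule ereal_convexD) (use phi in auto)
    moreover have "(1 - 1/2) *\<^sub>R z + (1/2) *\<^sub>R (2 *\<^sub>R y - z) = y" by (simp add: algebra_simps)
    moreover have "ereal (1 - 1/2) * \<phi> z = ereal (1/2 * real_of_ereal (\<phi> z))" by (subst z) simp
    ultimately have "\<phi> y \<le> ereal (1/2 * real_of_ereal (\<phi> z)) + ereal (1/2) * ereal (real n)"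
      by (metis add_left_mono order_trans)
    then show "\<phi> y \<le> ereal (1/2 * real_of_ereal (\<phi> z) + 1/2 * real n)" by simp
  qed
qed

text \<open>Lower semicontinuity gives one half. The other is convexity on the segment from
  \<open>x0\<close> to a point \<open>w\<close> at distance \<open>\<delta> / 2\<close>, where
  \<open>\<phi>\<close> is at most \<open>M\<close>: \<open>xs n\<close> lies at the fraction
  \<open>t n\<close> of this segment, and \<open>t n\<close> tends to 0.\<close>

lemma convex_lsc_continuous_at_interior:
  fixes \<phi> :: "'v::banach \<Rightarrow> ereal"
  assumes phi: "ereal_proper \<phi>" "ereal_convex \<phi>" "ereal_lsc \<phi>" and x0: "x0 \<in> interior (edom \<phi>)"
    and xs: "xs \<longlonglongrightarrow> x0"
  shows "(\<lambda>n. real_of_ereal (\<phi> (xs n))) \<longlonglongrightarrow> real_of_ereal (\<phi> x0)"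
proof -
  define \<psi> where "\<psi> x = real_of_ereal (\<phi> x)" for x
  have fin: "\<phi> x = ereal (\<psi> x)" if "x \<in> interior (edom \<phi>)" for x
    unfolding \<psi>_def using that interior_subset by (intro ereal_proper_edom phi) auto
  obtain \<delta> M where \<delta>: "\<delta> > 0" and M: "\<And>y. dist x0 y < \<delta> \<Longrightarrow> \<phi> y \<le> ereal M"
    using convex_lsc_locally_bounded_above[OF phi x0] by blast
  define t where "t n = 2 * dist (xs n) x0 / \<delta>" for n
  have tlim: "t \<longlonglongrightarrow> 0"
    unfolding t_def using tendsto_mult_right_zero[OF tendsto_divide_zero[OF tendsto_dist_iff[THEN iffD1, OF xs]], of 2 \<delta>]
    by simp
  have ev_dom: "\<forall>\<^sub>F n in sequentially. xs n \<in> interior (edom \<phi>)"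
    using topological_tendstoD[OF xs open_interior x0] .
  have upper: "\<psi> (xs n) \<le> (1 - t n) * \<psi> x0 + t n * M" if n: "t n < 1" "xs n \<in> interior (edom \<phi>)" for n
  proof (cases "xs n = x0")
    case False
    then have t: "t n > 0" using \<delta> by (simp add: t_def)
    define w where "w = x0 + (1 / t n) *\<^sub>R (xs n - x0)"
    have "dist x0 w = \<delta> / 2" using False \<delta> by (simp add: w_def t_def dist_norm)
    then have w: "\<phi> w \<le> ereal M" using M \<delta> by simp
    have "(1 - t n) *\<^sub>R x0 + t n *\<^sub>R w = xs n" using t by (simp add: w_def algebra_simps)
    then have "\<phi> (xs n) \<le> ereal (1 - t n) * \<phi> x0 + ereal (t n) * \<phi> w"
      using ereal_convexD[OF phi(2), of "t n" x0 w] t n by simp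
    also have "\<dots> \<le> ereal (1 - t n) * ereal (\<psi> x0) + ereal (t n) * ereal M"
      unfolding fin[OF x0] using w t by (intro add_left_mono ereal_mult_left_mono) auto
    finally show ?thesis using fin[OF n(2)] by simp
  qed (simp add: t_def)
  have "(\<lambda>n. (1 - t n) * \<psi> x0 + t n * M) \<longlonglongrightarrow> (1 - 0) * \<psi> x0 + 0 * M"
    by (intro tendsto_intros tlim)
  then have lim: "(\<lambda>n. (1 - t n) * \<psi> x0 + t n * M) \<longlonglongrightarrow> \<psi> x0" by simp
  have ev_t: "\<forall>\<^sub>F n in sequentially. t n < 1" using order_tendstoD(2)[OF tlim] by simp
  have "(\<psi> \<circ> xs) \<longlonglongrightarrow> \<psi> x0"
  proof (rule order_tendstoI)
    fix a assume "a < \<psi> x0"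
    then have "ereal a < liminf (\<lambda>n. \<phi> (xs n))"
      using phi(3) xs fin[OF x0] unfolding ereal_lsc_def by (metis less_ereal.simps(1) less_le_trans)
    from less_LiminfD[OF this] ev_dom show "\<forall>\<^sub>F n in sequentially. a < (\<psi> \<circ> xs) n"
      by eventually_elim (simp add: fin)
  next
    fix a assume "\<psi> x0 < a"
    from order_tendstoD(2)[OF lim this] ev_dom ev_t show "\<forall>\<^sub>F n in sequentially. (\<psi> \<circ> xs) n < a"
      by eventually_elim (use upper in force)
  qed
  then show ?thesis by (simp add: \<psi>_def comp_def)
qed

text \<open>Sublevel sets of \<open>\<psi>\<close> in \<open>C\<close> are closed and convex, hence
  weakly closed; values at most \<open>c\<close> at infinitely many indices would force
  \<open>\<psi> u \<le> c\<close>.\<close>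

lemma convex_weakly_lsc:
  fixes \<psi> :: "'v::real_normed_vector \<Rightarrow> real"
  assumes C: "closed C" and \<psi>: "convex_on C \<psi>" "continuous_on C \<psi>"
    and us: "\<And>n. us n \<in> C" "weakly_conv us u" and c: "c < \<psi> u"
  shows "\<forall>\<^sub>F n in sequentially. c < \<psi> (us n)"
proof (rule ccontr)
  assume "\<not> ?thesis"
  then have "\<exists>\<^sub>F n in sequentially. \<psi> (us n) \<le> c" by (simp add: frequently_def not_le)
  then have "infinite {n. \<psi> (us n) \<le> c}" by (simp add: frequently_cofinite flip: cofinite_eq_sequentially)
  then obtain s :: "nat \<Rightarrow> nat" where s: "strict_mono s" "\<And>n. \<psi> (us (s n)) \<le> c"
    using infinite_enumerate[of "{n. \<psi> (us n) \<le> c}"] by auto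
  have "closed (C \<inter> \<psi> -` {..c})"
    using C \<psi>(2) by (intro continuous_closed_preimage closed_atMost)
  moreover have "convex (C \<inter> \<psi> -` {..c})"
  proof (rule convexI)
    fix x y and p q :: real
    assume *: "x \<in> C \<inter> \<psi> -` {..c}" "y \<in> C \<inter> \<psi> -` {..c}" "0 \<le> p" "0 \<le> q" "p + q = 1"
    then have "\<psi> (p *\<^sub>R x + q *\<^sub>R y) \<le> p * \<psi> x + q * \<psi> y"
      using \<psi>(1) by (auto simp: convex_on_def)
    also have "\<dots> \<le> p * c + q * c" using * by (intro add_mono mult_left_mono) auto
    also have "\<dots> = c" using *(5) by (simp flip: distrib_right)
    finally show "p *\<^sub>R x + q *\<^sub>R y \<in> C \<inter> \<psi> -` {..c}"
      using * convexD[OF convex_on_imp_convex[OF \<psi>(1)]] by auto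
  qed
  moreover have "(us \<circ> s) n \<in> C \<inter> \<psi> -` {..c}" for n using us s by auto
  ultimately have "u \<in> C \<inter> \<psi> -` {..c}"
    using closed_convex_weakly_closed weakly_conv_subseq[OF us(2) s(1)] by blast
  with c show False by auto
qed

section \<open>Existence and stability for the quasi-variational inequality\<close>

text \<open>Here \<open>\<psi>\<close> is the finite part of \<open>\<phi>\<close> on \<open>C\<close>, \<open>j\<close> is the embedding of \<open>B\<close> into \<open>L\<close>, and
  coercivity enters only through the radius \<open>r\<close>.\<close>

locale mqvi =
  fixes T :: "'b::real_normed_vector \<Rightarrow> 'v::real_normed_vector \<Rightarrow> ('v \<Rightarrow>\<^sub>L real)"
    and \<psi> :: "'v \<Rightarrow> real" and K :: "'v \<Rightarrow> 'v set" and C :: "'v set"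
    and m :: "'v \<Rightarrow>\<^sub>L real" and A :: "'b set" and j :: "'b \<Rightarrow> 'l::real_normed_vector" and r :: real
  assumes refl: "reflexive_space TYPE('v)"
    and C: "C \<noteq> {}" "closed C" "convex C"
    and T_lin: "\<And>u. linear (\<lambda>a. T a u)"
    and T_mono: "\<And>a u v. a \<in> A \<Longrightarrow> blinfun_apply (T a u - T a v) (u - v) \<ge> 0"
    and T_cont: "\<And>a. a \<in> A \<Longrightarrow> continuous_on UNIV (T a)"
    and \<psi>_convex: "convex_on C \<psi>" and \<psi>_cont: "continuous_on C \<psi>"
    and K_sub: "\<And>u. u \<in> C \<Longrightarrow> K u \<subseteq> C \<and> K u \<noteq> {} \<and> closed (K u) \<and> convex (K u)"
    and K_i: "\<And>xs x y. (\<forall>n. xs n \<in> C) \<Longrightarrow> x \<in> C \<Longrightarrow> weakly_conv xs x \<Longrightarrow> y \<in> K x \<Longrightarrow>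
               \<exists>ys. (\<forall>n. ys n \<in> C \<and> ys n \<in> K (xs n)) \<and> ys \<longlonglongrightarrow> y"
    and K_ii: "\<And>xs ys x y. (\<forall>n. xs n \<in> C \<and> ys n \<in> C \<and> ys n \<in> K (xs n)) \<Longrightarrow>
               x \<in> C \<Longrightarrow> weakly_conv xs x \<Longrightarrow> weakly_conv ys y \<Longrightarrow> y \<in> K x"
    and A_bdd: "bounded A"
    and H2: "\<And>as a vs v us. (\<forall>n. as n \<in> A) \<Longrightarrow> bounded (range as) \<Longrightarrow> a \<in> A \<Longrightarrow>
               (\<lambda>n. j (as n)) \<longlonglongrightarrow> j a \<Longrightarrow> vs \<longlonglongrightarrow> v \<Longrightarrow> bounded (range us) \<Longrightarrow>
               limsup (\<lambda>n. ereal (blinfun_apply (T (as n - a) (vs n)) (us n))) \<le> 0"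
    and apriori: "\<And>a u. a \<in> A \<Longrightarrow> u \<in> C \<Longrightarrow> \<exists>v\<in>K u. norm v < r \<and>
       (blinfun_apply (T a u) (v - u) - blinfun_apply m (v - u) + \<psi> v - \<psi> u \<ge> 0 \<longrightarrow> norm u < r)"
begin

section \<open>Minty's formulation and removal of the norm bound\<close>

definition VI :: "'b \<Rightarrow> 'v \<Rightarrow> 'v \<Rightarrow> real" where
  "VI a u v = blinfun_apply (T a u) (v - u) - blinfun_apply m (v - u) + \<psi> v - \<psi> u"

text \<open>Since \<open>T\<close> sees only the test point, the dependence on \<open>u\<close> is a
  weakly continuous affine term minus \<open>\<psi>\<close>, hence weakly upper semicontinuous on
  \<open>C\<close>.\<close>

definition minty :: "'b \<Rightarrow> 'v \<Rightarrow> 'v \<Rightarrow> real" where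
  "minty a u v = blinfun_apply (T a v) (v - u) - blinfun_apply m (v - u) + \<psi> v - \<psi> u"

definition sol :: "'b \<Rightarrow> 'v set" where
  "sol a = {u \<in> C. u \<in> K u \<and> (\<forall>v\<in>K u. VI a u v \<ge> 0)}"

lemma VI_le_minty: "a \<in> A \<Longrightarrow> VI a u v \<le> minty a u v"
  using T_mono[of a v u] by (simp add: VI_def minty_def blinfun.diff_left)

lemma VI_convex_comb:
  assumes "u \<in> C" "v \<in> C" "0 \<le> t" "t \<le> 1"
  shows "VI a u (u + t *\<^sub>R (v - u)) \<le> t * VI a u v"
proof -
  have "\<psi> ((1 - t) *\<^sub>R u + t *\<^sub>R v) \<le> (1 - t) * \<psi> u + t * \<psi> v"
    using \<psi>_convex assms by (auto simp: convex_on_def)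
  moreover have "(1 - t) *\<^sub>R u + t *\<^sub>R v = u + t *\<^sub>R (v - u)" by (simp add: algebra_simps)
  ultimately show ?thesis
    by (simp add: VI_def blinfun.scaleR_right distrib_left right_diff_distrib left_diff_distrib)
qed

lemma segment_K:
  assumes "u \<in> C" "u \<in> K u" "v \<in> K u" "0 \<le> t" "t \<le> 1"
  shows "u + t *\<^sub>R (v - u) \<in> K u"
proof -
  have "(1 - t) *\<^sub>R u + t *\<^sub>R v \<in> K u"
    using K_sub[OF assms(1)] assms by (intro convexD) auto
  then show ?thesis by (simp add: algebra_simps)
qed

lemma segment_norm:
  fixes u v :: 'v
  assumes "norm u \<le> r" "norm v < r" "0 < t" "t \<le> 1"
  shows "norm (u + t *\<^sub>R (v - u)) < r"
proof -
  have "u + t *\<^sub>R (v - u) = (1 - t) *\<^sub>R u + t *\<^sub>R v" by (simp add: algebra_simps)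
  then have "norm (u + t *\<^sub>R (v - u)) \<le> (1 - t) * norm u + t * norm v"
    using norm_triangle_ineq[of "(1 - t) *\<^sub>R u" "t *\<^sub>R v"] assms by simp
  also have "\<dots> < (1 - t) * r + t * r"
    using assms by (intro add_le_less_mono mult_left_mono mult_strict_left_mono) auto
  finally show ?thesis by (simp add: algebra_simps)
qed

text \<open>Minty's trick: the hypothesis is applied at points \<open>w n\<close> of the segment
  from \<open>u\<close> to \<open>v\<close>. Convexity bounds the result by a multiple of the step
  length, and after division by it the argument of \<open>T\<close> moves back to \<open>u\<close>
  by norm continuity.\<close>

lemma minty_imp_VI:
  assumes a: "a \<in> A" and u: "u \<in> C" "u \<in> K u" "norm u \<le> r"
    and M: "\<And>v. v \<in> K u \<Longrightarrow> norm v < r \<Longrightarrow> 0 \<le> minty a u v"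
    and v: "v \<in> K u" "norm v < r"
  shows "0 \<le> VI a u v"
proof -
  define w where "w n = u + (1 / real (Suc n)) *\<^sub>R (v - u)" for n
  have vC: "v \<in> C" using K_sub[OF u(1)] v by blast
  have pos: "0 \<le> blinfun_apply (T a (w n)) (v - u) - blinfun_apply m (v - u) + \<psi> v - \<psi> u" for n
  proof -
    define t where "t = 1 / real (Suc n)"
    have t: "0 < t" "t \<le> 1" by (auto simp: t_def)
    have w: "w n = u + t *\<^sub>R (v - u)" by (simp add: w_def t_def)
    have "w n \<in> K u" "norm (w n) < r" unfolding w using t u v by (auto intro!: segment_K segment_norm)
    then have "0 \<le> minty a u (w n)" by (rule M)
    also have "minty a u (w n) = VI a u (w n) + t * (blinfun_apply (T a (w n)) (v - u) - blinfun_apply (T a u) (v - u))"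
      by (simp add: minty_def VI_def w blinfun.scaleR_right right_diff_distrib)
    also have "VI a u (w n) \<le> t * VI a u v"
      unfolding w using u vC t by (intro VI_convex_comb) auto
    finally have "0 \<le> t * (VI a u v + (blinfun_apply (T a (w n)) (v - u) - blinfun_apply (T a u) (v - u)))"
      by (simp add: distrib_left)
    then show ?thesis using t by (simp add: zero_le_mult_iff VI_def)
  qed
  have "(\<lambda>n. 1 / real (Suc n)) \<longlonglongrightarrow> 0"
    using LIMSEQ_inverse_real_of_nat by (simp add: inverse_eq_divide)
  then have "w \<longlonglongrightarrow> u + 0 *\<^sub>R (v - u)" unfolding w_def by (intro tendsto_intros)
  then have "(\<lambda>n. T a (w n)) \<longlonglongrightarrow> T a u"
    by (intro continuous_on_tendsto_compose[OF T_cont[OF a]]) auto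
  then have "(\<lambda>n. blinfun_apply (T a (w n)) (v - u) - blinfun_apply m (v - u) + \<psi> v - \<psi> u) \<longlonglongrightarrow> VI a u v"
    unfolding VI_def by (intro tendsto_intros)
  then show ?thesis by (rule LIMSEQ_le_const) (use pos in auto)
qed

text \<open>\<open>apriori\<close> improves the bound on \<open>u\<close> to a strict one. A short
  segment from \<open>u\<close> towards an arbitrary \<open>v\<close> then stays in the ball, and
  convexity along it transfers the inequality to \<open>v\<close>.\<close>

lemma minty_imp_sol:
  assumes a: "a \<in> A" and u: "u \<in> C" "u \<in> K u" "norm u \<le> r"
    and M: "\<And>v. v \<in> K u \<Longrightarrow> norm v < r \<Longrightarrow> 0 \<le> minty a u v"
  shows "u \<in> sol a"
proof -
  have V: "0 \<le> VI a u v" if "v \<in> K u" "norm v < r" for v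
    using minty_imp_VI[OF a u M that] .
  obtain v0 where "v0 \<in> K u" "norm v0 < r" "0 \<le> VI a u v0 \<Longrightarrow> norm u < r"
    using apriori[OF a u(1)] by (auto simp: VI_def)
  with V have ur: "norm u < r" by blast
  have "0 \<le> VI a u v" if v: "v \<in> K u" for v
  proof -
    \<comment> \<open>Keeps the displacement within half of the gap \<open>r - norm u\<close>; the
      added 1 covers \<open>v = u\<close>.\<close>
    define t where "t = min 1 ((r - norm u) / (2 * (norm (v - u) + 1)))"
    have den: "2 * (norm (v - u) + 1) > 0" by (simp add: add_nonneg_pos)
    have t: "0 < t" "t \<le> 1" using ur den by (auto simp: t_def)
    have "t * norm (v - u) \<le> (r - norm u) / (2 * (norm (v - u) + 1)) * norm (v - u)"
      by (intro mult_right_mono) (auto simp: t_def)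
    also have "\<dots> = (r - norm u) / 2 * (norm (v - u) / (norm (v - u) + 1))" using den by (simp add: field_simps)
    also have "\<dots> \<le> (r - norm u) / 2 * 1" using ur den by (intro mult_left_mono) auto
    finally have tn: "t * norm (v - u) < r - norm u" using ur by simp
    have "norm (u + t *\<^sub>R (v - u)) < r"
      using norm_triangle_ineq[of u "t *\<^sub>R (v - u)"] tn t by simp
    moreover have "u + t *\<^sub>R (v - u) \<in> K u" using t u v by (intro segment_K) auto
    ultimately have "0 \<le> VI a u (u + t *\<^sub>R (v - u))" using V by blast
    also have "\<dots> \<le> t * VI a u v" using t u v K_sub[OF u(1)] by (intro VI_convex_comb) auto
    finally show ?thesis using t by (simp add: zero_le_mult_iff)
  qed
  with u show ?thesis by (auto simp: sol_def)
qed

lemma sol_norm: assumes "a \<in> A" "u \<in> sol a" shows "norm u < r"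
proof -
  have u: "u \<in> C" using assms by (simp add: sol_def)
  obtain v0 where "v0 \<in> K u" "0 \<le> VI a u v0 \<longrightarrow> norm u < r"
    using apriori[OF assms(1) u] by (auto simp: VI_def)
  with assms show ?thesis by (auto simp: sol_def)
qed

lemma sol_minty: "a \<in> A \<Longrightarrow> u \<in> sol a \<Longrightarrow> v \<in> K u \<Longrightarrow> 0 \<le> minty a u v"
  using VI_le_minty[of a u v] by (force simp: sol_def)

text \<open>Serves stability with a varying parameter and weak closedness with a constant one. The
  test point is approximated strongly inside \<open>K (us n)\<close>, so the strict norm bound
  persists, and \<open>T a\<close> converges in norm while it is paired with merely weakly
  convergent differences.\<close>

lemma minty_limit:
  assumes as: "\<And>n. as n \<in> A" "a \<in> A" "(\<lambda>n. j (as n)) \<longlonglongrightarrow> j a"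
    and us: "\<And>n. us n \<in> C" "\<And>n. norm (us n) \<le> r" "weakly_conv us u" and v: "v \<in> K u" "norm v < r"
    and M: "\<And>n w. w \<in> K (us n) \<Longrightarrow> norm w < r \<Longrightarrow> 0 \<le> minty (as n) (us n) w"
  shows "0 \<le> minty a u v"
proof -
  have u: "u \<in> C" by (rule closed_convex_weakly_closed[OF C(2,3) us(1,3)])
  obtain vs where vs: "\<And>n. vs n \<in> C" "\<And>n. vs n \<in> K (us n)" "vs \<longlonglongrightarrow> v"
    using K_i[of us u v] us u v by blast
  have vC: "v \<in> C" using K_sub[OF u] v by blast
  define w where "w n = vs n - us n" for n
  have w_weak: "(\<lambda>n. blinfun_apply f (w n)) \<longlonglongrightarrow> blinfun_apply f (v - u)" for f :: "'v \<Rightarrow>\<^sub>L real"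
    unfolding w_def blinfun.diff_right
    using us(3) tendsto_imp_weakly_conv[OF vs(3)] by (intro tendsto_diff) (auto simp: weakly_conv_def)
  have "bounded (range vs)" using vs(3) by (simp add: convergentI convergent_imp_bounded)
  then obtain B where B: "\<And>n. norm (vs n) \<le> B" by (auto simp: bounded_iff)
  have wB: "norm (w n) \<le> B + r" for n
    unfolding w_def using norm_triangle_ineq4[of "vs n" "us n"] B[of n] us(2)[of n] by linarith
  then have wbdd: "bounded (range w)" by (auto simp: bounded_iff)
  have asb: "bounded (range as)" using as(1) A_bdd by (meson bounded_subset image_subset_iff)
  have Tv: "(\<lambda>n. T a (vs n)) \<longlonglongrightarrow> T a v"
    by (rule continuous_on_tendsto_compose[OF T_cont[OF as(2)] vs(3)]) auto
  have "(\<lambda>n. norm (T a (vs n) - T a v) * (B + r)) \<longlonglongrightarrow> 0 * (B + r)"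
    by (intro tendsto_intros) (use Tv in \<open>simp add: tendsto_norm_zero_iff LIM_zero_iff\<close>)
  then have "(\<lambda>n. norm (T a (vs n) - T a v) * (B + r)) \<longlonglongrightarrow> 0" by simp
  then have "(\<lambda>n. blinfun_apply (T a (vs n) - T a v) (w n)) \<longlonglongrightarrow> 0"
  proof (rule Lim_null_comparison[rotated], intro always_eventually allI)
    show "norm (blinfun_apply (T a (vs n) - T a v) (w n)) \<le> norm (T a (vs n) - T a v) * (B + r)" for n
      using norm_blinfun[of "T a (vs n) - T a v" "w n"] mult_left_mono[OF wB, of "norm (T a (vs n) - T a v)" n]
      by (meson norm_ge_zero order_trans)
  qed
  from tendsto_add[OF this w_weak[of "T a v"]]
  have lim1: "(\<lambda>n. blinfun_apply (T a (vs n)) (w n)) \<longlonglongrightarrow> blinfun_apply (T a v) (v - u)"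
    by (simp add: blinfun.diff_left)
  have lim2: "(\<lambda>n. \<psi> (vs n)) \<longlonglongrightarrow> \<psi> v"
    by (rule continuous_on_tendsto_compose[OF \<psi>_cont vs(3) vC]) (use vs in auto)
  have lim: "(\<lambda>n. blinfun_apply (T a (vs n)) (w n) - blinfun_apply m (w n) + \<psi> (vs n)) \<longlonglongrightarrow>
      blinfun_apply (T a v) (v - u) - blinfun_apply m (v - u) + \<psi> v"
    by (intro tendsto_intros lim1 lim2 w_weak)
  \<comment> \<open>Linearity in the parameter isolates \<open>T (as n - a) (vs n)\<close>, the one
    term of which only the limes superior is controlled.\<close>
  have split: "T (as n) (vs n) = T (as n - a) (vs n) + T a (vs n)" for n
    using linear_diff[OF T_lin, of "as n" a] by simp
  have "0 \<le> minty a u v + e" if e: "e > 0" for e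
  proof -
    define c where "c = blinfun_apply (T a v) (v - u) - blinfun_apply m (v - u) + \<psi> v + e / 3"
    have "limsup (\<lambda>n. ereal (blinfun_apply (T (as n - a) (vs n)) (w n))) < ereal (e / 3)"
      using H2[of as a vs v w] as asb vs(3) wbdd e by (simp add: le_less_trans)
    then have ev1: "\<forall>\<^sub>F n in sequentially. blinfun_apply (T (as n - a) (vs n)) (w n) < e / 3"
      using Limsup_lessD by fastforce
    have ev2: "\<forall>\<^sub>F n in sequentially. blinfun_apply (T a (vs n)) (w n) - blinfun_apply m (w n) + \<psi> (vs n) < c"
      using order_tendstoD(2)[OF lim] e by (simp add: c_def)
    have ev3: "\<forall>\<^sub>F n in sequentially. \<psi> u - e / 3 < \<psi> (us n)"
      by (rule convex_weakly_lsc[OF C(2) \<psi>_convex \<psi>_cont us(1,3)]) (use e in simp)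
    have ev4: "\<forall>\<^sub>F n in sequentially. norm (vs n) < r"
      using order_tendstoD(2)[OF tendsto_norm[OF vs(3)] v(2)] .
    from ev1 ev2 ev3 ev4 have "\<forall>\<^sub>F n in sequentially. 0 \<le> minty a u v + e"
    proof eventually_elim
      case (elim n)
      have "0 \<le> minty (as n) (us n) (vs n)" using M[OF vs(2)] elim by simp
      also have "\<dots> = blinfun_apply (T (as n - a) (vs n)) (w n)
          + (blinfun_apply (T a (vs n)) (w n) - blinfun_apply m (w n) + \<psi> (vs n)) - \<psi> (us n)"
        unfolding minty_def split w_def by (simp add: blinfun.add_left)
      finally show ?case using elim by (simp add: minty_def c_def)
    qed
    then show ?thesis by simp
  qed
  then show ?thesis by (rule field_le_epsilon)
qed

lemma sol_limit:
  assumes as: "\<And>n. as n \<in> A" "a \<in> A" "(\<lambda>n. j (as n)) \<longlonglongrightarrow> j a" and us: "\<And>n. us n \<in> sol (as n)"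
  obtains s u where "strict_mono s" "weakly_conv (us \<circ> s) u" "u \<in> sol a"
proof -
  have C': "us n \<in> C" "us n \<in> K (us n)" for n using us by (auto simp: sol_def)
  have b: "norm (us n) \<le> r" for n using sol_norm[OF as(1) us] by (simp add: less_imp_le)
  obtain s u where s: "strict_mono s" and u: "weakly_conv (us \<circ> s) u"
    using bounded_weakly_conv_subseq[OF refl, of us r] b by blast
  have uC: "u \<in> C" by (rule closed_convex_weakly_closed[OF C(2,3) _ u]) (use C' in auto)
  have ur: "u \<in> cball 0 r"
    by (rule closed_convex_weakly_closed[OF closed_cball convex_cball _ u]) (use b in auto)
  \<comment> \<open>The closedness of \<open>K\<close> is used with both sequences equal to the
    solutions themselves.\<close>
  have uK: "u \<in> K u" by (rule K_ii[OF _ uC u u]) (use C' in auto)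
  have "u \<in> sol a"
  proof (rule minty_imp_sol[OF as(2) uC uK])
    fix v assume v: "v \<in> K u" "norm v < r"
    show "0 \<le> minty a u v"
    proof (rule minty_limit[of "as \<circ> s" a "us \<circ> s" u v])
      show "(\<lambda>n. j ((as \<circ> s) n)) \<longlonglongrightarrow> j a"
        using LIMSEQ_subseq_LIMSEQ[OF as(3) s] by (simp add: comp_def)
    qed (use as C' b u v sol_minty[OF as(1) us] in auto)
  qed (use ur in auto)
  with s u show ?thesis by (rule that)
qed

section \<open>Existence of solutions\<close>

text \<open>\<open>None\<close> is Minty's inequality; \<open>Some f\<close> is one direction of
  separation, and a point outside its own \<open>K u\<close> violates it for some \<open>f\<close>.
  The bounds differ on purpose: strong approximation of a test point preserves a strict bound,
  whereas weak limits of witnesses preserve only a non-strict one.\<close>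

definition constraint_set :: "'b \<Rightarrow> ('v \<Rightarrow>\<^sub>L real) option \<Rightarrow> 'v set" where
  "constraint_set a i = {u \<in> C \<inter> cball 0 r. case i of
      None \<Rightarrow> \<forall>v\<in>K u. norm v < r \<longrightarrow> 0 \<le> minty a u v
    | Some f \<Rightarrow> \<exists>v\<in>K u. norm v \<le> r \<and> 0 \<le> blinfun_apply f (v - u)}"

lemma weakly_seq_closed_C: "weakly_seq_closed (C \<inter> cball 0 r)"
  by (rule weakly_seq_closedI)
    (rule closed_convex_weakly_closed, auto intro: C closed_Int convex_Int)

text \<open>For \<open>Some f\<close> the witnesses are bounded, so a subsequence converges weakly
  and its limit lies in \<open>K u\<close>. For \<open>None\<close> the parameter is kept constant
  in \<open>minty_limit\<close>.\<close>

lemma weakly_seq_closed_constraint_set: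
  assumes a: "a \<in> A"
  shows "weakly_seq_closed (constraint_set a i)"
proof (rule weakly_seq_closedI)
  fix us u assume us: "\<And>n. us n \<in> constraint_set a i" and conv: "weakly_conv us u"
  have usC: "us n \<in> C" "norm (us n) \<le> r" for n using us by (auto simp: constraint_set_def)
  have u: "u \<in> C \<inter> cball 0 r"
    by (rule weakly_seq_closed_C[unfolded weakly_seq_closed_def, rule_format, OF _ conv]) (use usC in auto)
  show "u \<in> constraint_set a i"
  proof (cases i)
    case None
    have "0 \<le> minty a u v" if "v \<in> K u" "norm v < r" for v
      by (rule minty_limit[of "\<lambda>_. a" a us u v]) (use a usC conv that us None in \<open>auto simp: constraint_set_def\<close>)
    with u None show ?thesis by (auto simp: constraint_set_def)
  next
    case (Some f)
    have "\<forall>n. \<exists>v. v \<in> K (us n) \<and> norm v \<le> r \<and> 0 \<le> blinfun_apply f (v - us n)"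
      using us Some by (fastforce simp: constraint_set_def)
    then obtain vs where vs: "\<And>n. vs n \<in> K (us n)" "\<And>n. norm (vs n) \<le> r" "\<And>n. 0 \<le> blinfun_apply f (vs n - us n)"
      unfolding choice_iff by blast
    obtain s v where s: "strict_mono s" and v: "weakly_conv (vs \<circ> s) v"
      using bounded_weakly_conv_subseq[OF refl, of vs r] vs(2) by blast
    note us' = weakly_conv_subseq[OF conv s]
    have vsC: "vs n \<in> C" for n using vs(1) K_sub[OF usC(1)] by blast
    have "v \<in> K u"
      by (rule K_ii[OF _ _ us' v]) (use u vs vsC usC in auto)
    moreover have "v \<in> cball 0 r"
      by (rule closed_convex_weakly_closed[OF closed_cball convex_cball _ v]) (use vs in auto)
    moreover have "(\<lambda>n. blinfun_apply f ((vs \<circ> s) n) - blinfun_apply f ((us \<circ> s) n)) \<longlonglongrightarrow> blinfun_apply f v - blinfun_apply f u"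
      using v us' unfolding weakly_conv_def by (intro tendsto_diff) auto
    then have "0 \<le> blinfun_apply f v - blinfun_apply f u"
      by (rule LIMSEQ_le_const) (use vs(3) in \<open>auto simp: blinfun.diff_right\<close>)
    ultimately show ?thesis using u Some by (auto simp: constraint_set_def blinfun.diff_right)
  qed
qed

lemma in_all_constraint_sets_imp_sol:
  assumes a: "a \<in> A" and u: "u \<in> C \<inter> cball 0 r" and all: "\<And>i. u \<in> constraint_set a i"
  shows "u \<in> sol a"
proof (rule minty_imp_sol[OF a])
  show "u \<in> K u"
  proof (rule ccontr)
    assume "u \<notin> K u"
    moreover have "closed (K u \<inter> cball 0 r)" "convex (K u \<inter> cball 0 r)"
      using K_sub u by (auto intro: convex_Int)
    ultimately obtain f :: "'v \<Rightarrow>\<^sub>L real" and \<delta> where f: "\<delta> > 0"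
      "\<And>y. y \<in> K u \<inter> cball 0 r \<Longrightarrow> blinfun_apply f u + \<delta> \<le> blinfun_apply f y"
      using separate_point_closed_convex[of "K u \<inter> cball 0 r" u] by blast
    from all[of "Some (- f)"] obtain v where "v \<in> K u" "norm v \<le> r" "0 \<le> blinfun_apply (- f) (v - u)"
      by (auto simp: constraint_set_def)
    with f(2)[of v] f(1) show False by (simp add: blinfun.minus_left blinfun.diff_right)
  qed
qed (use u all[of None] in \<open>auto simp: constraint_set_def\<close>)

text \<open>For \<open>u\<close> in \<open>C \<inter> cball 0 r\<close> outside
  \<open>constraint_set a i\<close> this is negative at points of \<open>K u\<close> in the ball: at
  some of them for \<open>None\<close>, at all of them for \<open>Some f\<close>.\<close>

definition probe :: "'b \<Rightarrow> ('v \<Rightarrow>\<^sub>L real) option \<Rightarrow> 'v \<Rightarrow> 'v \<Rightarrow> real" where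
  "probe a i u v = (case i of None \<Rightarrow> minty a u v | Some f \<Rightarrow> blinfun_apply f (v - u))"

text \<open>At the barycentre the averages of all linear terms cancel. What remains of
  \<open>VI\<close> is the Jensen gap of \<open>\<psi>\<close>, and monotonicity passes from
  \<open>VI\<close> to \<open>minty\<close>.\<close>

lemma probe_avg:
  assumes a: "a \<in> A" and c: "c \<in> weights n" and v: "\<And>k. k < n \<Longrightarrow> v k \<in> C"
  shows "0 \<le> (\<Sum>k<n. c k * probe a i (\<Sum>k<n. c k *\<^sub>R v k) (v k))"
proof -
  define u where "u = (\<Sum>k<n. c k *\<^sub>R v k)"
  have c0: "\<And>k. 0 \<le> c k" and c1: "(\<Sum>k<n. c k) = 1" using c by (auto simp: weights_def)
  have lin: "(\<Sum>k<n. c k * blinfun_apply f (v k - u)) = 0" for f :: "'v \<Rightarrow>\<^sub>L real"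
  proof -
    have "(\<Sum>k<n. c k * blinfun_apply f (v k - u)) = blinfun_apply f (\<Sum>k<n. c k *\<^sub>R (v k - u))"
      by (simp add: blinfun.sum_right blinfun.scaleR_right)
    also have "(\<Sum>k<n. c k *\<^sub>R (v k - u)) = u - (\<Sum>k<n. c k) *\<^sub>R u"
      by (simp add: scaleR_diff_right sum_subtractf u_def scaleR_left.sum)
    finally show ?thesis using c1 by (simp add: blinfun.zero_right)
  qed
  show ?thesis
  proof (cases i)
    case None
    have "\<psi> u \<le> (\<Sum>k<n. c k * \<psi> (v k))"
      unfolding u_def using c1 c0 v by (intro convex_on_sum[OF _ _ \<psi>_convex]) (auto intro: ccontr)
    moreover have "(\<Sum>k<n. c k * \<psi> (v k)) - \<psi> u = (\<Sum>k<n. c k * VI a u (v k))"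
    proof -
      have "(\<Sum>k<n. c k * VI a u (v k)) = (\<Sum>k<n. c k * blinfun_apply (T a u) (v k - u))
          - (\<Sum>k<n. c k * blinfun_apply m (v k - u)) + (\<Sum>k<n. c k * \<psi> (v k)) - (\<Sum>k<n. c k) * \<psi> u"
        by (simp add: VI_def algebra_simps sum.distrib sum_subtractf sum_distrib_left)
      then show ?thesis using lin c1 by simp
    qed
    moreover have "(\<Sum>k<n. c k * VI a u (v k)) \<le> (\<Sum>k<n. c k * minty a u (v k))"
      using VI_le_minty[OF a] c0 by (intro sum_mono mult_left_mono) auto
    ultimately show ?thesis by (simp add: probe_def None u_def)
  qed (use lin in \<open>simp add: probe_def u_def\<close>)
qed

lemma probe_continuous: "continuous_on C (\<lambda>u. probe a i u v)"
  by (cases i) (auto simp: probe_def minty_def intro!: continuous_intros \<psi>_cont)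

lemma probe_weakly_usc:
  assumes us: "\<And>n. us n \<in> C" "weakly_conv us u" and e: "e > 0"
  shows "\<forall>\<^sub>F n in sequentially. probe a i (us n) v < probe a i u v + e"
proof -
  have lim: "(\<lambda>n. blinfun_apply f (v - us n)) \<longlonglongrightarrow> blinfun_apply f (v - u)" for f :: "'v \<Rightarrow>\<^sub>L real"
    unfolding blinfun.diff_right using us(2) by (intro tendsto_diff tendsto_const) (simp add: weakly_conv_def)
  show ?thesis
  proof (cases i)
    case None
    have "(\<lambda>n. blinfun_apply (T a v) (v - us n) - blinfun_apply m (v - us n) + \<psi> v) \<longlonglongrightarrow>
        blinfun_apply (T a v) (v - u) - blinfun_apply m (v - u) + \<psi> v"
      by (intro tendsto_intros lim)
    from order_tendstoD(2)[OF this, of "blinfun_apply (T a v) (v - u) - blinfun_apply m (v - u) + \<psi> v + e / 2"] e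
    have 1: "\<forall>\<^sub>F n in sequentially. blinfun_apply (T a v) (v - us n) - blinfun_apply m (v - us n) + \<psi> v
        < blinfun_apply (T a v) (v - u) - blinfun_apply m (v - u) + \<psi> v + e / 2" by simp
    have 2: "\<forall>\<^sub>F n in sequentially. \<psi> u - e / 2 < \<psi> (us n)"
      by (rule convex_weakly_lsc[OF C(2) \<psi>_convex \<psi>_cont us]) (use e in simp)
    from 1 2 show ?thesis by eventually_elim (simp add: probe_def None minty_def)
  next
    case (Some f)
    show ?thesis using order_tendstoD(2)[OF lim[of f], of "probe a i u v + e"] e
      by (simp add: probe_def Some)
  qed
qed

theorem sol_nonempty:
  assumes a: "a \<in> A"
  shows "sol a \<noteq> {}"
proof
  assume empty: "sol a = {}"
  define X where "X = C \<inter> cball 0 r"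
  have "\<exists>i. u \<notin> constraint_set a i" if "u \<in> X" for u
    using in_all_constraint_sets_imp_sol[OF a] that empty by (auto simp: X_def)
  then obtain ix where ix: "\<And>u. u \<in> X \<Longrightarrow> u \<notin> constraint_set a (ix u)" by metis
  have sub: "constraint_set a i \<subseteq> cball 0 r" for i by (auto simp: constraint_set_def)
  have "\<exists>b :: (('v \<Rightarrow>\<^sub>L real) \<Rightarrow> real) \<Rightarrow> real. continuous_on UNIV b \<and> (\<forall>\<Phi>. 0 \<le> b \<Phi>) \<and> 0 < b (weak_map u) \<and>
      (\<forall>\<Phi>. 0 < b \<Phi> \<longrightarrow> \<Phi> \<notin> weak_map ` constraint_set a (ix u))" if u: "u \<in> X" for u
  proof -
    have op: "open (- weak_map ` constraint_set a (ix u))"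
      by (intro open_Compl weak_map_weakly_seq_closed(1)[OF refl sub weakly_seq_closed_constraint_set[OF a]])
    have mem: "weak_map u \<in> - weak_map ` constraint_set a (ix u)"
      using ix[OF u] inj_weak_map by (auto dest: injD)
    show ?thesis
    proof (rule product_bump[OF op mem])
      fix b :: "(('v \<Rightarrow>\<^sub>L real) \<Rightarrow> real) \<Rightarrow> real"
      assume "continuous_on UNIV b" "\<And>\<Phi>. 0 \<le> b \<Phi>" "0 < b (weak_map u)"
        "\<And>\<Phi>. 0 < b \<Phi> \<Longrightarrow> \<Phi> \<in> - weak_map ` constraint_set a (ix u)"
      then show ?thesis by (intro exI[of _ b]) auto
    qed
  qed
  then have "\<forall>u. \<exists>b :: (('v \<Rightarrow>\<^sub>L real) \<Rightarrow> real) \<Rightarrow> real. u \<in> X \<longrightarrow> continuous_on UNIV b \<and> (\<forall>\<Phi>. 0 \<le> b \<Phi>) \<and> 0 < b (weak_map u) \<and>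
      (\<forall>\<Phi>. 0 < b \<Phi> \<longrightarrow> \<Phi> \<notin> weak_map ` constraint_set a (ix u))" by blast
  then obtain b :: "'v \<Rightarrow> (('v \<Rightarrow>\<^sub>L real) \<Rightarrow> real) \<Rightarrow> real" where b: "\<And>u. u \<in> X \<Longrightarrow> continuous_on UNIV (b u)" "\<And>u \<Phi>. u \<in> X \<Longrightarrow> 0 \<le> b u \<Phi>"
    "\<And>u. u \<in> X \<Longrightarrow> 0 < b u (weak_map u)"
    "\<And>u \<Phi>. u \<in> X \<Longrightarrow> 0 < b u \<Phi> \<Longrightarrow> \<Phi> \<notin> weak_map ` constraint_set a (ix u)"
    unfolding choice_iff by blast
  have cX: "compact (weak_map ` X)"
    by (rule weak_map_weakly_seq_closed(2)[OF refl _ weakly_seq_closed_C[folded X_def]]) (auto simp: X_def)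
  obtain D where D: "D \<subseteq> X" "finite D" "weak_map ` X \<subseteq> (\<Union>d\<in>D. {\<Phi>. 0 < b d \<Phi>})"
  proof (rule compactE_image[OF cX, of X "\<lambda>u. {\<Phi>. 0 < b u \<Phi>}"])
    show "open {\<Phi>. 0 < b u \<Phi>}" if "u \<in> X" for u
      by (intro open_Collect_less continuous_intros b(1) that)
    show "weak_map ` X \<subseteq> (\<Union>u\<in>X. {\<Phi>. 0 < b u \<Phi>})" using b(3) by blast
  qed blast
  define \<beta> where "\<beta> d u = b d (weak_map u)" for d u
  \<comment> \<open>The weights are not normalised: only their signs and their weak continuity
    matter.\<close>
  define \<Psi> where "\<Psi> u v = (\<Sum>d\<in>D. \<beta> d u * probe a (ix d) u v)" for u v
  have \<beta>0: "0 \<le> \<beta> d u" if "d \<in> D" for d u using b(2) D(1) that by (auto simp: \<beta>_def)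
  have \<beta>_cont: "continuous_on S (\<beta> d)" if "d \<in> D" for d S
    unfolding \<beta>_def using D(1) that
    by (intro continuous_on_compose2[OF b(1) continuous_on_weak_map]) auto
  have \<beta>_lim: "(\<lambda>n. \<beta> d (us n)) \<longlonglongrightarrow> \<beta> d u" if "d \<in> D" "weakly_conv us u" for d us u
    unfolding \<beta>_def using D(1) that
    by (intro continuous_on_tendsto_compose[OF b(1) weakly_conv_tendsto]) auto
  have XC: "X \<subseteq> C" by (auto simp: X_def)
  have K_meet: "\<exists>v\<in>K u. norm v < r" if "u \<in> C" for u
    using apriori[OF a that] by blast
  obtain u where u: "u \<in> X" "\<And>v. v \<in> X \<Longrightarrow> 0 \<le> \<Psi> u v"
  proof (rule ky_fan_weak[OF refl, of X r \<Psi>])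
    obtain c where "c \<in> C" using C by blast
    then obtain v where "v \<in> K c" "norm v < r" using K_meet by blast
    then have "v \<in> X" using K_sub[OF \<open>c \<in> C\<close>] by (auto simp: X_def)
    then show "X \<noteq> {}" by blast
    show "X \<subseteq> cball 0 r" "convex X" unfolding X_def using C by (auto intro: convex_Int)
    show "continuous_on X (\<lambda>u. \<Psi> u v)" if "v \<in> X" for v
      unfolding \<Psi>_def by (intro continuous_intros \<beta>_cont continuous_on_subset[OF probe_continuous XC]) auto
    show "0 \<le> (\<Sum>k<n. c k * \<Psi> (\<Sum>k<n. c k *\<^sub>R v k) (v k))"
      if c: "c \<in> weights n" and v: "\<And>k. k < n \<Longrightarrow> v k \<in> X" for n c v
    proof -
      define w where "w = (\<Sum>k<n. c k *\<^sub>R v k)"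
      have "(\<Sum>k<n. c k * \<Psi> w (v k)) = (\<Sum>k<n. \<Sum>d\<in>D. \<beta> d w * (c k * probe a (ix d) w (v k)))"
        by (simp add: \<Psi>_def sum_distrib_left mult_ac)
      also have "\<dots> = (\<Sum>d\<in>D. \<Sum>k<n. \<beta> d w * (c k * probe a (ix d) w (v k)))" by (rule sum.swap)
      also have "\<dots> = (\<Sum>d\<in>D. \<beta> d w * (\<Sum>k<n. c k * probe a (ix d) w (v k)))"
        by (simp add: sum_distrib_left)
      also have "\<dots> \<ge> 0"
        unfolding w_def using XC v by (intro sum_nonneg mult_nonneg_nonneg \<beta>0 probe_avg[OF a c]) auto
      finally show ?thesis unfolding w_def .
    qed
    fix v assume "v \<in> X"
    show "weakly_seq_closed {u \<in> X. 0 \<le> \<Psi> u v}"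
    proof (rule weakly_seq_closedI)
      fix us u assume us: "\<And>n. us n \<in> {u \<in> X. 0 \<le> \<Psi> u v}" and conv: "weakly_conv us u"
      have u: "u \<in> X"
        by (rule weakly_seq_closed_C[folded X_def, unfolded weakly_seq_closed_def, rule_format, OF _ conv])
          (use us in auto)
      have "0 \<le> \<Psi> u v + e" if e: "e > 0" for e
      proof -
        define S where "S = (\<Sum>d\<in>D. \<beta> d u)"
        have S: "S \<ge> 0" unfolding S_def by (intro sum_nonneg \<beta>0)
        \<comment> \<open>Makes the total error \<open>S * e'\<close> at most \<open>e\<close>; the
          added 1 covers a vanishing sum of weights.\<close>
        define e' where "e' = e / (S + 1)"
        have e': "e' > 0" using e S by (simp add: e'_def)
        have ev: "\<forall>\<^sub>F n in sequentially. \<forall>d\<in>D. probe a (ix d) (us n) v < probe a (ix d) u v + e'"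
          using D(2) us XC conv e' by (intro eventually_ball_finite ballI probe_weakly_usc) auto
        \<comment> \<open>The weights converge because the bumps are weakly continuous, so a
          one-sided estimate of the probes is enough.\<close>
        have lim: "(\<lambda>n. \<Sum>d\<in>D. \<beta> d (us n) * (probe a (ix d) u v + e')) \<longlonglongrightarrow>
            (\<Sum>d\<in>D. \<beta> d u * (probe a (ix d) u v + e'))"
          by (intro tendsto_intros \<beta>_lim conv)
        have "0 \<le> (\<Sum>d\<in>D. \<beta> d u * (probe a (ix d) u v + e'))"
        proof (rule tendsto_lowerbound[OF lim])
          from ev show "\<forall>\<^sub>F n in sequentially. 0 \<le> (\<Sum>d\<in>D. \<beta> d (us n) * (probe a (ix d) u v + e'))"
          proof eventually_elim
            case (elim n)
            have "0 \<le> \<Psi> (us n) v" using us by simp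
            also have "\<dots> \<le> (\<Sum>d\<in>D. \<beta> d (us n) * (probe a (ix d) u v + e'))"
              unfolding \<Psi>_def using elim by (intro sum_mono mult_left_mono \<beta>0) (auto simp: less_imp_le)
            finally show ?case .
          qed
        qed simp
        also have "\<dots> = \<Psi> u v + S * e'"
          by (simp add: \<Psi>_def S_def distrib_left sum.distrib sum_distrib_right)
        also have "S * e' \<le> e" using S e by (simp add: e'_def divide_le_eq field_simps)
        finally show ?thesis by simp
      qed
      then have "0 \<le> \<Psi> u v" by (rule field_le_epsilon)
      with u show "u \<in> {u \<in> X. 0 \<le> \<Psi> u v}" by simp
    qed
  qed blast
  have act: "u \<notin> constraint_set a (ix d)" if "d \<in> D" "\<beta> d u > 0" for d
    using b(4)[of d "weak_map u"] that D(1) by (auto simp: \<beta>_def)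
  have uC: "u \<in> C" using u XC by blast
  \<comment> \<open>One test point has to violate every active condition. The functional conditions
    fail at all points of \<open>K u\<close> in the ball, so only Minty's condition, a single index,
    restricts the choice.\<close>
  have "\<exists>v\<in>K u. norm v < r \<and> (\<forall>d\<in>D. \<beta> d u > 0 \<longrightarrow> ix d = None \<longrightarrow> minty a u v < 0)"
  proof (cases "\<exists>d\<in>D. \<beta> d u > 0 \<and> ix d = None")
    case True
    then obtain d where "d \<in> D" "\<beta> d u > 0" "ix d = None" by blast
    with act have "u \<notin> constraint_set a None" by metis
    with u(1) obtain v where "v \<in> K u" "norm v < r" "\<not> 0 \<le> minty a u v"
      unfolding constraint_set_def X_def by auto
    then show ?thesis by (auto simp: not_le)
  qed (use K_meet[OF uC] in blast)
  then obtain v where v: "v \<in> K u" "norm v < r" "\<And>d. d \<in> D \<Longrightarrow> \<beta> d u > 0 \<Longrightarrow> ix d = None \<Longrightarrow> minty a u v < 0"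
    by blast
  have neg: "probe a (ix d) u v < 0" if d: "d \<in> D" "\<beta> d u > 0" for d
  proof (cases "ix d")
    case None
    then show ?thesis using v(3)[OF d] by (simp add: probe_def)
  next
    case (Some f)
    with act[OF d] u(1) have "\<not> (\<exists>v\<in>K u. norm v \<le> r \<and> 0 \<le> blinfun_apply f (v - u))"
      by (auto simp: constraint_set_def X_def)
    with v have "\<not> 0 \<le> blinfun_apply f (v - u)" by (meson less_imp_le)
    then show ?thesis using Some by (simp add: probe_def)
  qed
  obtain d where d: "d \<in> D" "\<beta> d u > 0" using D(3) u(1) by (auto simp: \<beta>_def)
  have "\<Psi> u v < 0"
    unfolding \<Psi>_def
  proof -
    have "(\<Sum>d\<in>D. \<beta> d u * probe a (ix d) u v) < (\<Sum>d\<in>D. 0)"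
    proof (rule sum_strict_mono_ex1[OF D(2)])
      show "\<forall>d\<in>D. \<beta> d u * probe a (ix d) u v \<le> 0"
      proof
        fix d assume "d \<in> D"
        then show "\<beta> d u * probe a (ix d) u v \<le> 0"
          using \<beta>0[of d u] neg[of d] by (cases "\<beta> d u = 0") (auto simp: mult_le_0_iff less_imp_le)
      qed
      show "\<exists>d\<in>D. \<beta> d u * probe a (ix d) u v < 0"
        using d neg[OF d] by (intro bexI[of _ d]) (auto simp: mult_less_0_iff)
    qed
    then show "(\<Sum>d\<in>D. \<beta> d u * probe a (ix d) u v) < 0" by simp
  qed
  moreover have "v \<in> X" using v K_sub[OF uC] by (auto simp: X_def)
  ultimately show False using u(2) by force
qed

end

section \<open>The optimal control problem\<close>

lemma convex_half_square_dist:
  fixes L :: "'v::real_vector \<Rightarrow> 'z::real_normed_vector"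
  assumes "linear L"
  shows "convex_on UNIV (\<lambda>u. (1/2) * (norm (L u - z))\<^sup>2)"
  unfolding convex_on_def
proof (intro conjI ballI allI impI)
  fix x y and p q :: real assume p: "0 \<le> p" "0 \<le> q" "p + q = 1"
  have "L (p *\<^sub>R x + q *\<^sub>R y) - z = L (p *\<^sub>R x + q *\<^sub>R y) - (p + q) *\<^sub>R z" using p by simp
  also have "\<dots> = p *\<^sub>R (L x - z) + q *\<^sub>R (L y - z)"
    by (simp add: linear_add[OF assms] linear_scale[OF assms] algebra_simps)
  finally have "norm (L (p *\<^sub>R x + q *\<^sub>R y) - z) \<le> p * norm (L x - z) + q * norm (L y - z)"
    using norm_triangle_ineq[of "p *\<^sub>R (L x - z)" "q *\<^sub>R (L y - z)"] p by simp
  then have "(norm (L (p *\<^sub>R x + q *\<^sub>R y) - z))\<^sup>2 \<le> (p * norm (L x - z) + q * norm (L y - z))\<^sup>2"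
    by (intro power_mono) auto
  also have "\<dots> \<le> p * (norm (L x - z))\<^sup>2 + q * (norm (L y - z))\<^sup>2"
    using convex_power2 p unfolding convex_on_def by (metis UNIV_I real_scaleR_def)
  finally show "(1/2) * (norm (L (p *\<^sub>R x + q *\<^sub>R y) - z))\<^sup>2
      \<le> p * ((1/2) * (norm (L x - z))\<^sup>2) + q * ((1/2) * (norm (L y - z))\<^sup>2)" by simp
qed simp

lemma ex_minimizing_sequence:
  fixes f :: "'a \<Rightarrow> real"
  assumes "S \<noteq> {}" "bdd_below (f ` S)"
  obtains xs where "\<And>n. xs n \<in> S" "\<And>n. f (xs n) < Inf (f ` S) + 1 / real (Suc n)"
proof -
  have "\<forall>n. \<exists>x. x \<in> S \<and> f x < Inf (f ` S) + 1 / real (Suc n)"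
  proof
    fix n
    have "Inf (f ` S) < Inf (f ` S) + 1 / real (Suc n)" by simp
    then show "\<exists>x. x \<in> S \<and> f x < Inf (f ` S) + 1 / real (Suc n)"
      using cInf_lessD[of "f ` S"] assms(1) by blast
  qed
  then show ?thesis using that unfolding choice_iff by blast
qed

text \<open>The embeddings of \<open>B\<close> and \<open>E\<close> meet in the type of
  \<open>L\<close>, so \<open>inv iEL (iBL a)\<close> is the point of \<open>E\<close> identified
  with the parameter \<open>a\<close>.\<close>

theorem theorem2p5:
  fixes T :: "'b::banach \<Rightarrow> 'v::banach \<Rightarrow> ('v \<Rightarrow>\<^sub>L real)"
    and \<phi> :: "'v \<Rightarrow> ereal"
    and K :: "'v \<Rightarrow> 'v set"
    and C C0 :: "'v set"
    and m :: "'v \<Rightarrow>\<^sub>L real"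
    and A :: "'b set"
    and h :: "real \<Rightarrow> real"
    and iBL :: "'b \<Rightarrow> 'l::banach"
    and iEL :: "'e::banach \<Rightarrow> 'l"
    and R :: "'e \<Rightarrow> real"
    and \<tau>1 \<tau>2 :: real
    and iZ :: "'v \<Rightarrow> 'z::{real_inner, complete_space}"
    and z :: 'z
  assumes V_refl: "reflexive_space TYPE('v)"
    and C: "C \<noteq> {}" "closed C" "convex C"
    and A_ne: "A \<noteq> {}"
    (* (H_T) *)
    and T_bdd: "\<And>S. bounded S \<Longrightarrow> bounded ((\<lambda>(a, u). T a u) ` S)"
    and T_lin: "\<And>u. linear (\<lambda>a. T a u)"
    and T_mono: "\<And>a u v. a \<in> A \<Longrightarrow> blinfun_apply (T a u - T a v) (u - v) \<ge> 0"
    and T_cont: "\<And>a. a \<in> A \<Longrightarrow> continuous_on UNIV (T a)"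
    (* (H_phi) *)
    and phi: "ereal_proper \<phi>" "ereal_convex \<phi>" "ereal_lsc \<phi>"
    and C_dom: "C \<subseteq> interior (edom \<phi>)"
    (* (H_K) *)
    and K_sub: "\<And>u. u \<in> C \<Longrightarrow> K u \<subseteq> C \<and> K u \<noteq> {} \<and> closed (K u) \<and> convex (K u)"
    and K_i: "\<And>xs x y. (\<forall>n. xs n \<in> C) \<Longrightarrow> x \<in> C \<Longrightarrow> weakly_conv xs x \<Longrightarrow> y \<in> K x \<Longrightarrow>
               \<exists>ys. (\<forall>n. ys n \<in> C \<and> ys n \<in> K (xs n)) \<and> ys \<longlonglongrightarrow> y"
    and K_ii: "\<And>xs ys x y. (\<forall>n. xs n \<in> C \<and> ys n \<in> C \<and> ys n \<in> K (xs n)) \<Longrightarrow>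
               x \<in> C \<Longrightarrow> weakly_conv xs x \<Longrightarrow> weakly_conv ys y \<Longrightarrow> y \<in> K x"
    (* (H_0) *)
    and C0_bdd: "bounded C0"
    and C0_meet: "\<And>u. u \<in> C \<Longrightarrow> K u \<inter> C0 \<noteq> {}"
    and h_lim: "filterlim h at_top at_top"
    and coerc: "\<And>v0 a w. v0 \<in> C0 \<Longrightarrow> a \<in> A \<Longrightarrow> w \<in> C \<Longrightarrow>
               ereal (blinfun_apply (T a w) (w - v0)) + \<phi> w - \<phi> v0 \<ge> ereal (h (norm w) * norm w)"
    (* (H_1) *)
    and iBL: "continuous_embedding iBL"
    and iEL: "compact_embedding iEL"
    and A_in_E: "\<And>a. a \<in> A \<Longrightarrow> iBL a \<in> range iEL"
    and A_closed: "closed A" "bounded A" "closed (iBL ` A)"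
    (* (H_2) *)
    and H2: "\<And>as a vs v us. (\<forall>n. as n \<in> A) \<Longrightarrow> bounded (range as) \<Longrightarrow> a \<in> A \<Longrightarrow>
               (\<lambda>n. iBL (as n)) \<longlonglongrightarrow> iBL a \<Longrightarrow> vs \<longlonglongrightarrow> v \<Longrightarrow> bounded (range us) \<Longrightarrow>
               limsup (\<lambda>n. ereal (blinfun_apply (T (as n - a) (vs n)) (us n))) \<le> 0"
    (* (H_3) *)
    and R_conv: "convex_on UNIV R"
    and R_lsc: "\<And>es e. (\<lambda>n. iEL (es n)) \<longlonglongrightarrow> iEL e \<Longrightarrow> ereal (R e) \<le> liminf (\<lambda>n. ereal (R (es n)))"
    and tau: "\<tau>1 > 0" "\<tau>2 > 0"
    and R_coerc: "\<And>a. a \<in> A \<Longrightarrow> R (inv iEL (iBL a)) \<ge> \<tau>1 * norm (inv iEL (iBL a)) - \<tau>2"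
    (* Z Hilbert, V continuously embedded *)
    and iZ: "continuous_embedding iZ"
  shows "(\<forall>a\<in>A. \<exists>u\<in>MQVI_sol T \<phi> K C m a. \<forall>w\<in>MQVI_sol T \<phi> K C m a.
              (1/2) * (norm (iZ u - z))\<^sup>2 \<le> (1/2) * (norm (iZ w - z))\<^sup>2)
         \<and> (\<forall>\<kappa>>0. \<exists>a\<in>A. \<forall>b\<in>A.
              Jfun iZ z (MQVI_sol T \<phi> K C m) R (\<lambda>a. inv iEL (iBL a)) \<kappa> a
              \<le> Jfun iZ z (MQVI_sol T \<phi> K C m) R (\<lambda>a. inv iEL (iBL a)) \<kappa> b)"
proof -
  let ?\<Gamma> = "MQVI_sol T \<phi> K C m"
  define \<psi> where "\<psi> v = real_of_ereal (\<phi> v)" for v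
  have fin: "\<phi> v = ereal (\<psi> v)" if "v \<in> C" for v
    unfolding \<psi>_def using C_dom interior_subset that by (intro ereal_proper_edom phi) auto
  have \<psi>_cont: "continuous_on C \<psi>"
    unfolding continuous_on_sequentially comp_def \<psi>_def
    using convex_lsc_continuous_at_interior[OF phi] C_dom by blast
  have \<psi>_convex: "convex_on C \<psi>"
    unfolding convex_on_def
  proof (intro conjI ballI allI impI C)
    fix x y and p q :: real assume *: "x \<in> C" "y \<in> C" "0 \<le> p" "0 \<le> q" "p + q = 1"
    then have "p *\<^sub>R x + q *\<^sub>R y \<in> C" using C by (simp add: convexD)
    moreover have "\<phi> ((1 - q) *\<^sub>R x + q *\<^sub>R y) \<le> ereal (1 - q) * \<phi> x + ereal q * \<phi> y"
      using * by (intro ereal_convexD phi) auto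
    moreover have "1 - q = p" using * by simp
    ultimately show "\<psi> (p *\<^sub>R x + q *\<^sub>R y) \<le> p * \<psi> x + q * \<psi> y"
      using * by (simp add: fin)
  qed
  obtain c0 where c0: "c0 \<ge> 0" "\<And>v. v \<in> C0 \<Longrightarrow> norm v \<le> c0"
    using C0_bdd by (meson bounded_pos less_imp_le)
  \<comment> \<open>From this threshold on and for norms at least 1,
    \<open>h (norm u) * norm u\<close> exceeds \<open>norm m * (norm u + c0)\<close>, the most that
    \<open>m\<close> can contribute against a point of \<open>C0\<close>.\<close>
  obtain N where N: "\<And>t. t \<ge> N \<Longrightarrow> norm m * (1 + c0) + 1 \<le> h t"
    using h_lim unfolding filterlim_at_top eventually_at_top_linorder by blast
  \<comment> \<open>Large enough for coercivity, at least 1 to absorb the constants, and above every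
    norm in \<open>C0\<close>, so that each \<open>K u\<close> meets the open ball.\<close>
  define r where "r = max (max N 1) (c0 + 1)"
  have apriori: "\<exists>v\<in>K u. norm v < r \<and>
      (blinfun_apply (T a u) (v - u) - blinfun_apply m (v - u) + \<psi> v - \<psi> u \<ge> 0 \<longrightarrow> norm u < r)"
    if a: "a \<in> A" and u: "u \<in> C" for a u
  proof -
    obtain v where v: "v \<in> K u" "v \<in> C0" using C0_meet[OF u] by blast
    then have vC: "v \<in> C" using K_sub[OF u] by blast
    have "norm u < r" if V: "blinfun_apply (T a u) (v - u) - blinfun_apply m (v - u) + \<psi> v - \<psi> u \<ge> 0"
    proof (rule ccontr)
      assume "\<not> norm u < r"
      then have t: "N \<le> norm u" "1 \<le> norm u" by (auto simp: r_def)
      have "norm m * c0 * 1 \<le> norm m * c0 * norm u"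
        using t c0 by (intro mult_left_mono) auto
      then have "norm m * (norm u + c0) + 1 \<le> (norm m * (1 + c0) + 1) * norm u"
        using t by (simp add: algebra_simps)
      also have "\<dots> \<le> h (norm u) * norm u" using N[OF t(1)] by (intro mult_right_mono) auto
      also have "\<dots> \<le> blinfun_apply (T a u) (u - v) + \<psi> u - \<psi> v"
        using coerc[OF v(2) a u] fin[OF u] fin[OF vC] by simp
      also have "\<dots> \<le> blinfun_apply m (u - v)" using V by (simp add: blinfun.diff_right)
      also have "\<dots> \<le> norm m * norm (u - v)" using norm_blinfun[of m "u - v"] by simp
      also have "\<dots> \<le> norm m * (norm u + c0)"
        using norm_triangle_ineq4[of u v] c0(2)[OF v(2)] by (intro mult_left_mono) auto
      finally show False by simp
    qed
    moreover have "norm v < r" using c0(2)[OF v(2)] by (simp add: r_def)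
    ultimately show ?thesis using v by blast
  qed
  interpret mqvi T \<psi> K C m A iBL r
    by (rule mqvi.intro) (fact V_refl C T_lin T_mono T_cont \<psi>_convex \<psi>_cont K_sub K_i K_ii A_closed(2) H2 apriori)+
  have \<Gamma>: "?\<Gamma> a = sol a" for a
  proof -
    have "ereal (blinfun_apply m (v - u)) \<le> ereal (blinfun_apply (T a u) (v - u)) + \<phi> v - \<phi> u \<longleftrightarrow> 0 \<le> VI a u v"
      if "u \<in> C" "v \<in> K u" for u v
      using fin[OF that(1)] fin[of v] K_sub[OF that(1)] that by (auto simp: VI_def)
    then show ?thesis unfolding MQVI_sol_def sol_def by blast
  qed
  define F where "F u = (1/2) * (norm (iZ u - z))\<^sup>2" for u
  have iZ_bl: "bounded_linear iZ" using iZ by (simp add: continuous_embedding_def)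
  have F_lsc: "\<forall>\<^sub>F n in sequentially. c < F (us n)" if "weakly_conv us u" "c < F u" for us u c
  proof (rule convex_weakly_lsc[where C = UNIV and us = us and u = u])
    show "convex_on UNIV F"
      unfolding F_def using iZ_bl by (intro convex_half_square_dist bounded_linear.linear)
    show "continuous_on UNIV F"
      unfolding F_def by (intro continuous_intros linear_continuous_on iZ_bl)
  qed (use that in auto)
  have inv_lim: "(\<lambda>n. 1 / real (Suc n)) \<longlonglongrightarrow> 0"
    using LIMSEQ_inverse_real_of_nat by (simp add: inverse_eq_divide)
  have F0: "bdd_below (F ` S)" for S by (rule bdd_belowI[of _ 0]) (auto simp: F_def)
  have ex_min: "\<exists>u\<in>?\<Gamma> a. \<forall>w\<in>?\<Gamma> a. F u \<le> F w" if a: "a \<in> A" for a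
  proof -
    obtain us where us: "\<And>n. us n \<in> sol a" "\<And>n. F (us n) < Inf (F ` sol a) + 1 / real (Suc n)"
      using ex_minimizing_sequence[OF sol_nonempty[OF a] F0] by blast
    obtain s u where s: "strict_mono s" and u: "weakly_conv (us \<circ> s) u" "u \<in> sol a"
      by (rule sol_limit[of "\<lambda>_. a" a us]) (use a us in auto)
    have "F u \<le> Inf (F ` sol a)"
    proof (rule ccontr)
      assume "\<not> F u \<le> Inf (F ` sol a)"
      then obtain c where c: "Inf (F ` sol a) < c" "c < F u" using dense not_le by metis
      have "(\<lambda>n. Inf (F ` sol a) + 1 / real (Suc (s n))) \<longlonglongrightarrow> Inf (F ` sol a) + 0"
        by (intro tendsto_intros LIMSEQ_subseq_LIMSEQ[OF inv_lim s, unfolded comp_def])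
      then have "\<forall>\<^sub>F n in sequentially. Inf (F ` sol a) + 1 / real (Suc (s n)) < c"
        using c by (intro order_tendstoD(2)) auto
      with F_lsc[OF u(1) c(2)] have "\<forall>\<^sub>F n in sequentially. False"
      proof eventually_elim
        case (elim n)
        with us(2)[of "s n"] show False by (simp add: comp_def)
      qed
      then show False by simp
    qed
    moreover have "Inf (F ` sol a) \<le> F w" if "w \<in> sol a" for w
      by (rule cINF_lower[OF F0 that])
    ultimately show ?thesis using u(2) unfolding \<Gamma> by force
  qed
  have "\<exists>a\<in>A. \<forall>b\<in>A. Jfun iZ z ?\<Gamma> R (\<lambda>a. inv iEL (iBL a)) \<kappa> a \<le> Jfun iZ z ?\<Gamma> R (\<lambda>a. inv iEL (iBL a)) \<kappa> b"
    if \<kappa>: "\<kappa> > 0" for \<kappa>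
  proof -
    define e where "e a = inv iEL (iBL a)" for a
    define J where "J a = Jfun iZ z ?\<Gamma> R e \<kappa> a" for a
    have iEL_e: "iEL (e a) = iBL a" if "a \<in> A" for a
      unfolding e_def by (rule f_inv_into_f[OF A_in_E[OF that]])
    have J_le: "J a \<le> F u + \<kappa> * R (e a)" if "u \<in> sol a" for a u
      using cINF_lower[OF F0 that] by (simp add: J_def Jfun_def \<Gamma> F_def)
    have J_eq: "\<exists>u\<in>sol a. J a = F u + \<kappa> * R (e a)" if a: "a \<in> A" for a
    proof -
      obtain u where u: "u \<in> sol a" "\<And>w. w \<in> sol a \<Longrightarrow> F u \<le> F w" using ex_min[OF a] unfolding \<Gamma> by blast
      then have "(INF w\<in>sol a. F w) = F u" by (intro cInf_eq_minimum) auto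
      with u(1) show ?thesis by (intro bexI[of _ u]) (auto simp: J_def Jfun_def \<Gamma> F_def)
    qed
    \<comment> \<open>The tracking term is nonnegative, so the coercivity of \<open>R\<close> alone
      bounds a minimizing sequence in \<open>E\<close>.\<close>
    have J_ge: "\<kappa> * (\<tau>1 * norm (e a) - \<tau>2) \<le> J a" if a: "a \<in> A" for a
    proof -
      obtain u where "J a = F u + \<kappa> * R (e a)" using J_eq[OF a] by blast
      moreover have "0 \<le> F u" by (simp add: F_def)
      moreover have "\<kappa> * (\<tau>1 * norm (e a) - \<tau>2) \<le> \<kappa> * R (e a)"
        using R_coerc[OF a] \<kappa> by (intro mult_left_mono) (auto simp: e_def)
      ultimately show ?thesis by linarith
    qed
    have bdd: "bdd_below (J ` A)"
    proof (rule bdd_belowI2)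
      fix a assume a: "a \<in> A"
      have "\<kappa> * - \<tau>2 \<le> \<kappa> * (\<tau>1 * norm (e a) - \<tau>2)" using \<kappa> tau by (intro mult_left_mono) auto
      with J_ge[OF a] show "\<kappa> * - \<tau>2 \<le> J a" by linarith
    qed
    define I where "I = Inf (J ` A)"
    obtain as where as: "\<And>n. as n \<in> A" "\<And>n. J (as n) < I + 1 / real (Suc n)"
      unfolding I_def using ex_minimizing_sequence[OF A_ne bdd] by blast
    have "norm (e (as n)) \<le> ((I + 1) / \<kappa> + \<tau>2) / \<tau>1" for n
    proof -
      have "1 / real (Suc n) \<le> 1" by simp
      then have "\<kappa> * (\<tau>1 * norm (e (as n)) - \<tau>2) \<le> I + 1"
        using J_ge[OF as(1), of n] as(2)[of n] by linarith
      then have "\<tau>1 * norm (e (as n)) - \<tau>2 \<le> (I + 1) / \<kappa>"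
        using \<kappa> by (simp add: pos_le_divide_eq mult.commute)
      then show ?thesis using tau by (simp add: pos_le_divide_eq mult.commute)
    qed
    then have "bounded (range (\<lambda>n. e (as n)))" by (auto simp: bounded_iff)
    \<comment> \<open>Compactness is gained in \<open>L\<close> and not in \<open>B\<close>:
      boundedness in \<open>E\<close> gives a subsequence convergent there, and closedness of the
      image of \<open>A\<close> brings the limit back to a parameter.\<close>
    then have "seq_compact (closure (iEL ` range (\<lambda>n. e (as n))))"
      using iEL by (intro compact_imp_seq_compact) (auto simp: compact_embedding_def)
    moreover have "\<forall>n. iBL (as n) \<in> closure (iEL ` range (\<lambda>n. e (as n)))"
      using iEL_e[OF as(1)] closure_subset by (metis (no_types, lifting) image_eqI rangeI subsetD)
    ultimately obtain l \<sigma> where \<sigma>: "strict_mono (\<sigma> :: nat \<Rightarrow> nat)" and l: "((\<lambda>n. iBL (as n)) \<circ> \<sigma>) \<longlonglongrightarrow> l"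
      by (rule seq_compactE)
    have "l \<in> iBL ` A"
      using closed_sequentially[OF A_closed(3) _ l] as(1) by auto
    then obtain a where a: "a \<in> A" "l = iBL a" by blast
    have "\<forall>n. \<exists>u. u \<in> sol (as (\<sigma> n)) \<and> J (as (\<sigma> n)) = F u + \<kappa> * R (e (as (\<sigma> n)))"
      using J_eq[OF as(1)] by blast
    then obtain us where us: "\<And>n. us n \<in> sol (as (\<sigma> n))"
      "\<And>n. J (as (\<sigma> n)) = F (us n) + \<kappa> * R (e (as (\<sigma> n)))"
      unfolding choice_iff by blast
    obtain s u where s: "strict_mono s" and u: "weakly_conv (us \<circ> s) u" "u \<in> sol a"
      by (rule sol_limit[of "\<lambda>n. as (\<sigma> n)" a us]) (use as(1) a l us in \<open>auto simp: comp_def\<close>)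
    have "J a \<le> I"
    proof (rule ccontr)
      assume "\<not> J a \<le> I"
      with J_le[OF u(2)] have pos: "F u + \<kappa> * R (e a) - I > 0" by linarith
      \<comment> \<open>One third for each loss: the tracking term, the regularisation term and the
        distance of the minimizing sequence from \<open>I\<close>.\<close>
      define \<delta> where "\<delta> = (F u + \<kappa> * R (e a) - I) / 3"
      have \<delta>: "\<delta> > 0" using pos by (simp add: \<delta>_def)
      have ev1: "\<forall>\<^sub>F n in sequentially. F u - \<delta> < F ((us \<circ> s) n)"
        by (rule F_lsc[OF u(1)]) (use \<delta> in simp)
      have "(\<lambda>n. iEL (e (as (\<sigma> (s n))))) \<longlonglongrightarrow> iEL (e a)"
        using LIMSEQ_subseq_LIMSEQ[OF l s] a iEL_e as(1) by (simp add: comp_def)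
      then have "ereal (R (e a)) \<le> liminf (\<lambda>n. ereal (R (e (as (\<sigma> (s n))))))" by (rule R_lsc)
      moreover have "ereal (R (e a) - \<delta> / \<kappa>) < ereal (R (e a))" using \<delta> \<kappa> by simp
      ultimately have "ereal (R (e a) - \<delta> / \<kappa>) < liminf (\<lambda>n. ereal (R (e (as (\<sigma> (s n))))))"
        by (rule less_le_trans[rotated])
      from less_LiminfD[OF this]
      have ev2: "\<forall>\<^sub>F n in sequentially. R (e a) - \<delta> / \<kappa> < R (e (as (\<sigma> (s n))))" by simp
      have ev3: "\<forall>\<^sub>F n in sequentially. 1 / real (Suc (\<sigma> (s n))) < \<delta>"
        using order_tendstoD(2)[OF LIMSEQ_subseq_LIMSEQ[OF LIMSEQ_subseq_LIMSEQ[OF inv_lim \<sigma>] s] \<delta>]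
        by (simp add: comp_def)
      from ev1 ev2 ev3 have "\<forall>\<^sub>F n in sequentially. False"
      proof eventually_elim
        case (elim n)
        have "\<kappa> * (R (e a) - \<delta> / \<kappa>) < \<kappa> * R (e (as (\<sigma> (s n))))"
          using elim(2) \<kappa> by (rule mult_strict_left_mono)
        then have "\<kappa> * R (e a) - \<delta> < \<kappa> * R (e (as (\<sigma> (s n))))" using \<kappa> by (simp add: right_diff_distrib)
        moreover have "F u + \<kappa> * R (e a) = I + 3 * \<delta>" by (simp add: \<delta>_def field_simps)
        moreover have "F u - \<delta> < F (us (s n))" using elim(1) by simp
        ultimately show ?case using elim(3) us(2)[of "s n"] as(2)[of "\<sigma> (s n)"] by linarith
      qed
      then show False by simp
    qed
    moreover have "I \<le> J b" if "b \<in> A" for b unfolding I_def by (rule cINF_lower[OF bdd that])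
    ultimately show ?thesis using a(1) unfolding J_def e_def by (meson order_trans)
  qed
  with ex_min show ?thesis unfolding F_def by blast
qed

end
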